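(* Let $s\in\mathbb{R}^n$ consist of the first $n$ samples of an ergodic source with mean $0$ and variance $\sigma^2$, independent of a design matrix $A\in\mathbb{R}^{n\times ML}$ with i.i.d. $\mathcal{N}(0,1/n)$ entries, where $L\ln M=nR$. Let $\delta_0,\delta_1,\delta_2>0$ satisfy $\Delta:=\delta_0+5R(\delta_1+\delta_2)<\frac12$. Let $A\hat\beta$ be the codeword produced by the successive cancellation encoder (see context). Then for all sufficiently large $M,L$, $$\mathbb{P}\Big(\frac1n\|s-A\hat\beta\|^2>\sigma^2e^{-2R}(1+e^R\Delta)^2\Big)<p_0+p_1+p_2,$$ where $p_0=\mathbb{P}\big(\big|\frac{\|s\|}{\sqrt n\,\sigma}-1\big|>\delta_0\big)$, $p_1=2ML\exp(-n\delta_1^2/8)$, and $p_2=\big(\frac{8\log M}{M^{2\delta_2}}\big)^L$.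
   Context: Columns of $A$ are $A_1,\dots,A_{ML}$, grouped into $L$ sections of $M$ consecutive columns. Coefficients: $c_\ell=\sqrt{2(\ln M)\sigma^2(1-\frac{2R}{L})^{\ell-1}}$, $\ell\in[L]$. Successive cancellation encoder: $r_0=s$; for $\ell=1,\dots,L$, let $m_\ell=\arg\max_{(\ell-1)M<j\le\ell M}\langle\sqrt n A_j,\,r_{\ell-1}/\|r_{\ell-1}\|\rangle$ and $r_\ell=r_{\ell-1}-c_\ell A_{m_\ell}$. The output $\hat\beta\in\mathbb{R}^{ML}$ has entry $c_\ell$ in position $m_\ell$ for each $\ell$ and zeros elsewhere, so $s-A\hat\beta=r_L$. Rate $R$ is in nats. *)

theory Defs
  imports "HOL-Probability.Probability"
begin

text \<open>Vectors in R^n are represented as functions nat => real, only indices i < n matter.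
  Matrices (n x ML) as functions nat => nat => real, indices i < n, j < M*L.
  Sections and columns are 0-indexed: section l (0 <= l < L) consists of the columns
  j with l*M <= j < (l+1)*M; coefficient index l corresponds to the paper's l+1.\<close>

definition vnorm :: "nat \<Rightarrow> (nat \<Rightarrow> real) \<Rightarrow> real" where
  "vnorm n r = sqrt (\<Sum>i<n. (r i)^2)"

definition sc_coef :: "real \<Rightarrow> real \<Rightarrow> nat \<Rightarrow> nat \<Rightarrow> nat \<Rightarrow> real" where
  "sc_coef \<sigma> R M L l = sqrt (2 * ln (real M) * \<sigma>^2 * (1 - 2 * R / real L) ^ l)"

definition sc_score :: "nat \<Rightarrow> (nat \<Rightarrow> nat \<Rightarrow> real) \<Rightarrow> (nat \<Rightarrow> real) \<Rightarrow> nat \<Rightarrow> real" where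
  "sc_score n A r j = (\<Sum>i<n. (sqrt (real n) * A i j) * (r i / vnorm n r))"

definition sc_select :: "nat \<Rightarrow> nat \<Rightarrow> (nat \<Rightarrow> nat \<Rightarrow> real) \<Rightarrow> (nat \<Rightarrow> real) \<Rightarrow> nat \<Rightarrow> nat" where
  "sc_select n M A r l = (LEAST j. l * M \<le> j \<and> j < Suc l * M \<and>
      (\<forall>k. l * M \<le> k \<and> k < Suc l * M \<longrightarrow> sc_score n A r k \<le> sc_score n A r j))"

fun sc_res :: "real \<Rightarrow> real \<Rightarrow> nat \<Rightarrow> nat \<Rightarrow> nat \<Rightarrow> (nat \<Rightarrow> nat \<Rightarrow> real) \<Rightarrow> (nat \<Rightarrow> real)
      \<Rightarrow> nat \<Rightarrow> (nat \<Rightarrow> real)" where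
  "sc_res \<sigma> R n M L A s 0 = s"
| "sc_res \<sigma> R n M L A s (Suc l) =
     (let r = sc_res \<sigma> R n M L A s l
      in (\<lambda>i. r i - sc_coef \<sigma> R M L l * A i (sc_select n M A r l)))"

definition sc_beta :: "real \<Rightarrow> real \<Rightarrow> nat \<Rightarrow> nat \<Rightarrow> nat \<Rightarrow> (nat \<Rightarrow> nat \<Rightarrow> real) \<Rightarrow> (nat \<Rightarrow> real)
      \<Rightarrow> nat \<Rightarrow> real" where
  "sc_beta \<sigma> R n M L A s j =
     (let l = j div M in
      if l < L \<and> j = sc_select n M A (sc_res \<sigma> R n M L A s l) l then sc_coef \<sigma> R M L l else 0)"

definition sc_codeword :: "real \<Rightarrow> real \<Rightarrow> nat \<Rightarrow> nat \<Rightarrow> nat \<Rightarrow> (nat \<Rightarrow> nat \<Rightarrow> real) \<Rightarrow> (nat \<Rightarrow> real)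
      \<Rightarrow> nat \<Rightarrow> real" where
  "sc_codeword \<sigma> R n M L A s i = (\<Sum>j<M * L. A i j * sc_beta \<sigma> R n M L A s j)"

definition process_law :: "'a measure \<Rightarrow> (nat \<Rightarrow> 'a \<Rightarrow> real) \<Rightarrow> (nat \<Rightarrow> real) measure" where
  "process_law P X = distr P (PiM UNIV (\<lambda>_. borel)) (\<lambda>\<omega> i. X i \<omega>)"

definition stationary_process :: "'a measure \<Rightarrow> (nat \<Rightarrow> 'a \<Rightarrow> real) \<Rightarrow> bool" where
  "stationary_process P X \<longleftrightarrow> (\<forall>i. X i \<in> borel_measurable P) \<and>
     (\<forall>k. distr P (PiM UNIV (\<lambda>_. borel)) (\<lambda>\<omega> i. X (i + k) \<omega>) = process_law P X)"

definition ergodic_process :: "'a measure \<Rightarrow> (nat \<Rightarrow> 'a \<Rightarrow> real) \<Rightarrow> bool" where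
  "ergodic_process P X \<longleftrightarrow> stationary_process P X \<and>
     (\<forall>B \<in> sets (PiM (UNIV :: nat set) (\<lambda>_. borel :: real measure)).
        (\<lambda>x i. x (Suc i)) -` B \<inter> space (PiM UNIV (\<lambda>_. borel)) = B \<longrightarrow>
        emeasure (process_law P X) B = 0 \<or> emeasure (process_law P X) B = 1)"

end

theory Submission
  imports Defs "HOL-Real_Asymp.Real_Asymp"
begin

text \<open>Put \<open>q = 1 - 2R/L\<close>, \<open>h = (2R/L)/q\<close> and write the norm of the residual after \<open>l\<close> steps as
  \<open>sqrt n * \<sigma> * q^(l/2) * u l\<close>. If the column chosen in step \<open>l\<close> has squared norm at most \<open>1 + g l\<close> and
  score at least \<open>(1 - e l) * sqrt (2 ln M)\<close>, expanding the square gives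
  \<open>(u (l+1))^2 \<le> (u l)^2 + h * ((u l - 1)^2 + g l + 2 * u l * e l)\<close>. Only upper bounds on \<open>u\<close> matter, and
  \<open>u l \<le> 1 + D l\<close> is preserved by the linear recursion \<open>D (l+1) = (1 + h/2) * D l + h * (g l / 2 + e l)\<close>,
  so \<open>D L\<close> is about \<open>e^R * (\<delta>\<^sub>0 + (R/L) * (\<Sum>g) + (2R/L) * (\<Sum>e))\<close>. It suffices that
  \<open>(\<Sum>g) \<le> 4 * \<delta>\<^sub>1 * L\<close> and \<open>(\<Sum>e) \<le> 2 * \<delta>\<^sub>2 * L\<close>; the constant 5 in the statement leaves room for
  the limit \<open>L \<rightarrow> \<infinity>\<close>.

  The first sum is controlled by a union bound over the at most \<open>(M + 1)^L\<close> choices of one or no column per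
  section, combined with a Chernoff bound for chi-square variables; since this bound is exponential in \<open>n * L\<close>,
  it eventually beats \<open>p\<^sub>1\<close> for every \<open>\<delta>\<^sub>1\<close>, however large. For the second sum, given the source and the
  earlier sections, the scores in section \<open>l\<close> are independent standard normal variables, so the conditional
  expectation of \<open>M^(e l)\<close> is at most \<open>8 ln M\<close>; Markov's inequality for the product over all sections
  yields \<open>p\<^sub>2\<close>.\<close>

section \<open>Deterministic analysis of the encoder\<close>

lemma vnorm_nonneg: "0 \<le> vnorm n r"
  by (simp add: vnorm_def sum_nonneg)

lemma vnorm_sq: "(vnorm n r)\<^sup>2 = (\<Sum>i<n. (r i)\<^sup>2)"
  by (simp add: vnorm_def sum_nonneg)

lemma vnorm_cong: "(\<And>i. i < n \<Longrightarrow> r i = r' i) \<Longrightarrow> vnorm n r = vnorm n r'"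
  by (simp add: vnorm_def)

lemma sc_score_cong:
  assumes "\<And>i. i < n \<Longrightarrow> A i j = A' i j" "\<And>i. i < n \<Longrightarrow> r i = r' i"
  shows "sc_score n A r j = sc_score n A' r' j"
  using assms vnorm_cong[of n r r'] by (simp add: sc_score_def)

text \<open>A section with \<open>M > 0\<close> columns is finite and nonempty, so the largest score
  is attained and \<open>LEAST\<close> meets a satisfiable predicate; ties go to the smallest
  index.\<close>

lemma sc_select_props:
  assumes "M > 0"
  shows sc_select_lower: "l * M \<le> sc_select n M A r l"
    and sc_select_upper: "sc_select n M A r l < Suc l * M"
    and sc_select_max: "\<And>k. l * M \<le> k \<Longrightarrow> k < Suc l * M \<Longrightarrow>
          sc_score n A r k \<le> sc_score n A r (sc_select n M A r l)"
proof -
  let ?S = "{l * M..<Suc l * M}"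
  let ?P = "\<lambda>j. l * M \<le> j \<and> j < Suc l * M \<and>
      (\<forall>k. l * M \<le> k \<and> k < Suc l * M \<longrightarrow> sc_score n A r k \<le> sc_score n A r j)"
  have "finite ?S" "?S \<noteq> {}" using assms by auto
  then have "Max (sc_score n A r ` ?S) \<in> sc_score n A r ` ?S"
    by (intro Max_in) auto
  then obtain j where j: "j \<in> ?S" "sc_score n A r j = Max (sc_score n A r ` ?S)"
    by (metis imageE)
  have "sc_score n A r k \<le> sc_score n A r j" if "k \<in> ?S" for k
    unfolding j(2) using that \<open>finite ?S\<close> by (intro Max_ge) auto
  then have "?P j" using j(1) by auto
  then have *: "?P (sc_select n M A r l)"
    unfolding sc_select_def by (rule LeastI)
  show "l * M \<le> sc_select n M A r l" using * by blast
  show "sc_select n M A r l < Suc l * M" using * by blast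
  show "\<And>k. l * M \<le> k \<Longrightarrow> k < Suc l * M \<Longrightarrow>
          sc_score n A r k \<le> sc_score n A r (sc_select n M A r l)" using * by blast
qed

lemma sc_select_cong:
  assumes "\<And>i j. i < n \<Longrightarrow> l * M \<le> j \<Longrightarrow> j < Suc l * M \<Longrightarrow> A i j = A' i j"
    and "\<And>i. i < n \<Longrightarrow> r i = r' i"
  shows "sc_select n M A r l = sc_select n M A' r' l"
proof -
  have "sc_score n A r j = sc_score n A' r' j" if "l * M \<le> j" "j < Suc l * M" for j
    using that assms by (intro sc_score_cong) auto
  then show ?thesis unfolding sc_select_def
    by (intro arg_cong[where f = Least] ext) (auto cong: conj_cong)
qed

text \<open>The residual before step \<open>l\<close> is built from columns of earlier sections
  alone. This later allows it to be frozen while section \<open>l\<close> stays random.\<close>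

lemma sc_res_cong:
  assumes "M > 0"
    and "\<And>i j. i < n \<Longrightarrow> j < l * M \<Longrightarrow> A i j = A' i j"
    and "\<And>i. i < n \<Longrightarrow> s i = s' i" and "i < n"
  shows "sc_res \<sigma> R n M L A s l i = sc_res \<sigma> R n M L A' s' l i"
  using assms(2,4)
proof (induction l arbitrary: i)
  case 0
  then show ?case using assms(3) by simp
next
  case (Suc l)
  let ?r = "sc_res \<sigma> R n M L A s l" and ?r' = "sc_res \<sigma> R n M L A' s' l"
  have r: "?r i = ?r' i" if "i < n" for i
    using that Suc.prems(1) by (intro Suc.IH) auto
  have "sc_select n M A ?r l = sc_select n M A' ?r' l"
    using r Suc.prems(1) by (intro sc_select_cong) auto
  moreover have "A i (sc_select n M A ?r l) = A' i (sc_select n M A ?r l)"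
    using sc_select_upper[OF assms(1)] Suc.prems by blast
  ultimately show ?case using r Suc.prems(2) by (simp add: Let_def)
qed

lemma sc_res_eq_sum:
  "sc_res \<sigma> R n M L A s l i =
     s i - (\<Sum>k<l. sc_coef \<sigma> R M L k * A i (sc_select n M A (sc_res \<sigma> R n M L A s k) k))"
  by (induction l) (simp_all add: Let_def)

text \<open>Grouping the columns by section, recovered as \<open>j div M\<close>, leaves one nonzero
  term per section, which is exactly what the recursion subtracts.\<close>

lemma sc_codeword_residual:
  assumes "M > 0"
  shows "s i - sc_codeword \<sigma> R n M L A s i = sc_res \<sigma> R n M L A s L i"
proof -
  let ?m = "\<lambda>l. sc_select n M A (sc_res \<sigma> R n M L A s l) l"
  have "sc_codeword \<sigma> R n M L A s i
      = (\<Sum>l<L. \<Sum>j\<in>{l*M..<l*M+M}. A i j * sc_beta \<sigma> R n M L A s j)"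
    unfolding sc_codeword_def by (simp add: sum.nat_group mult.commute)
  also have "\<dots> = (\<Sum>l<L. sc_coef \<sigma> R M L l * A i (?m l))"
  proof (rule sum.cong[OF refl])
    fix l assume l: "l \<in> {..<L}"
    have "(\<Sum>j\<in>{l*M..<l*M+M}. A i j * sc_beta \<sigma> R n M L A s j)
       = (\<Sum>j\<in>{l*M..<l*M+M}. if j = ?m l then sc_coef \<sigma> R M L l * A i j else 0)"
    proof (rule sum.cong[OF refl])
      fix j assume "j \<in> {l*M..<l*M+M}"
      then have "j div M = l"
        by (intro div_nat_eqI) (auto simp: algebra_simps)
      then show "A i j * sc_beta \<sigma> R n M L A s j
          = (if j = ?m l then sc_coef \<sigma> R M L l * A i j else 0)"
        using l by (simp add: sc_beta_def Let_def)
    qed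
    also have "\<dots> = sc_coef \<sigma> R M L l * A i (?m l)"
      using sc_select_lower[OF assms] sc_select_upper[OF assms]
      by (simp add: add.commute)
    finally show "(\<Sum>j\<in>{l*M..<l*M+M}. A i j * sc_beta \<sigma> R n M L A s j)
      = sc_coef \<sigma> R M L l * A i (?m l)" .
  qed
  finally show ?thesis by (simp add: sc_res_eq_sum)
qed

section \<open>Growth of the residual norm\<close>

text \<open>Undoes the normalisation inside the score. A zero residual is a separate case, in which
  both sides vanish.\<close>

lemma sc_inner_eq:
  assumes "n > 0"
  shows "(\<Sum>i<n. A i j * r i) = vnorm n r * sc_score n A r j / sqrt n"
proof (cases "vnorm n r = 0")
  case True
  then have "\<forall>i<n. r i = 0"
    by (simp add: vnorm_def sum_nonneg_eq_0_iff)
  then show ?thesis using True by simp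
next
  case False
  then show ?thesis using assms
    by (simp add: sc_score_def sum_distrib_left sum_divide_distrib field_simps)
qed

lemma vnorm_step:
  assumes "n > 0"
  shows "(vnorm n (\<lambda>i. r i - c * A i m))\<^sup>2
    = (vnorm n r)\<^sup>2 - 2 * c * vnorm n r * sc_score n A r m / sqrt n + c\<^sup>2 * (\<Sum>i<n. (A i m)\<^sup>2)"
proof -
  have "(vnorm n (\<lambda>i. r i - c * A i m))\<^sup>2
    = (\<Sum>i<n. (r i)\<^sup>2) - 2 * c * (\<Sum>i<n. A i m * r i) + c\<^sup>2 * (\<Sum>i<n. (A i m)\<^sup>2)"
    unfolding vnorm_sq
    by (simp add: power2_diff sum.distrib sum_subtractf sum_distrib_left power_mult_distrib algebra_simps)
  then show ?thesis by (simp add: vnorm_sq sc_inner_eq[OF assms])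
qed

text \<open>For \<open>u \<le> 1\<close> the hypothesis \<open>h \<le> 1\<close> keeps
  \<open>u^2 + h * (u - 1)^2\<close> below 1; for \<open>u > 1\<close> the expression increases with
  \<open>u\<close>. So \<open>u\<close> may be replaced by \<open>1 + D\<close>, and the result is
  compared with the square of \<open>1 + D + ?k\<close>.\<close>

lemma deviation_step:
  fixes u u' D h g e :: real
  assumes "0 \<le> u" "u \<le> 1 + D" "0 \<le> D" "0 \<le> h" "h \<le> 1" "0 \<le> g" "0 \<le> e"
    and "u'\<^sup>2 \<le> u\<^sup>2 + h * ((u - 1)\<^sup>2 + g + 2 * u * e)"
  shows "u' \<le> 1 + ((1 + h/2) * D + h * (g/2 + e))"
proof -
  let ?k = "D * (h/2) + h * (g/2 + e)"
  have k: "0 \<le> ?k" using assms by simp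
  have "u\<^sup>2 + h * (u - 1)\<^sup>2 \<le> (1 + D)\<^sup>2 + h * D\<^sup>2"
  proof (cases "u \<le> 1")
    case True
    have "u\<^sup>2 + h * (u - 1)\<^sup>2 \<le> u\<^sup>2 + 1 * (u - 1)\<^sup>2"
      using assms by (intro add_mono mult_right_mono) auto
    also have "\<dots> \<le> 1"
    proof -
      have "0 \<le> u * (1 - u)" using True assms by simp
      then show ?thesis by (simp add: power2_eq_square algebra_simps)
    qed
    also have "\<dots> \<le> (1 + D)\<^sup>2" using assms by (simp add: power2_eq_square algebra_simps)
    finally show ?thesis using assms by (smt (verit) mult_nonneg_nonneg zero_le_power2)
  next
    case False
    then show ?thesis using assms
      by (intro add_mono mult_left_mono power_mono) auto
  qed
  moreover have "h * (2 * u * e) \<le> h * (2 * (1 + D) * e)"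
    using assms by (intro mult_left_mono mult_right_mono) auto
  ultimately have "u'\<^sup>2 \<le> (1 + D)\<^sup>2 + h * (D\<^sup>2 + g + 2 * (1 + D) * e)"
    using assms(8) by (simp add: algebra_simps)
  also have "\<dots> \<le> (1 + D)\<^sup>2 + 2 * ?k * (1 + D)"
  proof -
    \<comment> \<open>The quadratic term \<open>h * D^2\<close> is absorbed by the cross term
      \<open>2 * ?k * D\<close>, which keeps the recursion linear in \<open>D\<close>.\<close>
    have "2 * ?k * (1 + D) - h * (D\<^sup>2 + g + 2 * (1 + D) * e) = h * D + h * g * D"
      by (simp add: power2_eq_square algebra_simps)
    moreover have "0 \<le> h * D + h * g * D" using assms by simp
    ultimately show ?thesis by linarith
  qed
  also have "\<dots> \<le> (1 + D)\<^sup>2 + 2 * ?k * (1 + D) + ?k\<^sup>2" by simp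
  also have "\<dots> = (1 + D + ?k)\<^sup>2"
    by (simp only: power2_sum mult_ac)
  finally have "u' \<le> 1 + D + ?k"
    using power2_le_imp_le[of u'] k assms by simp
  then show ?thesis by (simp add: algebra_simps)
qed

text \<open>Unrolls the linear recursion, giving every error the largest amplification factor so
  that only the total of the errors matters.\<close>

lemma deviation_recursion:
  fixes u g e :: "nat \<Rightarrow> real"
  assumes "\<And>l. 0 \<le> u l" "u 0 \<le> 1 + d" "0 \<le> d" "0 \<le> h" "h \<le> 1"
    and "\<And>l. 0 \<le> g l" "\<And>l. 0 \<le> e l"
    and "\<And>l. l < L \<Longrightarrow> (u (Suc l))\<^sup>2 \<le> (u l)\<^sup>2 + h * ((u l - 1)\<^sup>2 + g l + 2 * u l * e l)"
    and "l \<le> L"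
  shows "u l \<le> 1 + (1 + h/2) ^ l * (d + h * (\<Sum>k<l. g k / 2 + e k))"
  using assms(9)
proof (induction l)
  case 0
  then show ?case using assms by simp
next
  case (Suc l)
  let ?D = "(1 + h/2) ^ l * (d + h * (\<Sum>k<l. g k / 2 + e k))"
  have D: "0 \<le> ?D" using assms(3,4,6,7) by (intro mult_nonneg_nonneg add_nonneg_nonneg sum_nonneg) auto
  have "u (Suc l) \<le> 1 + ((1 + h/2) * ?D + h * (g l/2 + e l))"
    using Suc assms D by (intro deviation_step[of "u l"]) auto
  \<comment> \<open>The error of the current step is multiplied by a factor of at least 1, to share
    the common amplification.\<close>
  also have "\<dots> \<le> 1 + ((1 + h/2) * ?D + (1 + h/2) ^ Suc l * (h * (g l/2 + e l)))"
  proof -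
    have "1 * (h * (g l/2 + e l)) \<le> (1 + h/2) ^ Suc l * (h * (g l/2 + e l))"
      using assms(4,6,7) by (intro mult_right_mono one_le_power mult_nonneg_nonneg add_nonneg_nonneg) auto
    then show ?thesis by simp
  qed
  also have "(1 + h/2) * ?D + (1 + h/2) ^ Suc l * (h * (g l/2 + e l))
      = (1 + h/2) ^ Suc l * (d + h * (\<Sum>k<Suc l. g k / 2 + e k))"
    by (simp only: power_Suc sum.lessThan_Suc distrib_left mult.assoc add.assoc)
  finally show ?case .
qed

text \<open>Dividing the residual norm by its ideal value reduces the encoder to
  \<open>deviation_recursion\<close>. The exponentials come from \<open>1 + x \<le> exp x\<close>,
  applied to the decay \<open>1 - 2 * R / L\<close> and to the amplification
  \<open>1 + h/2\<close>.\<close>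

lemma sc_distortion_bound:
  fixes \<sigma> R \<delta>0 :: real
  assumes "n > 0" "M \<ge> 2" "\<sigma> > 0" "R > 0" "4 * R \<le> real L"
    and rate: "real L * ln (real M) = real n * R"
    and "0 \<le> \<delta>0" "vnorm n s \<le> sqrt n * \<sigma> * (1 + \<delta>0)"
    and ge: "\<And>l. 0 \<le> g l" "\<And>l. 0 \<le> e l"
    and g: "\<And>l. l < L \<Longrightarrow> (\<Sum>i<n. (A i (sc_select n M A (sc_res \<sigma> R n M L A s l) l))\<^sup>2) \<le> 1 + g l"
    and e: "\<And>l. l < L \<Longrightarrow> vnorm n (sc_res \<sigma> R n M L A s l) \<noteq> 0 \<Longrightarrow>
       sqrt (2 * ln M) * (1 - e l) \<le> sc_score n A (sc_res \<sigma> R n M L A s l)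
          (sc_select n M A (sc_res \<sigma> R n M L A s l) l)"
  shows "1 / n * (vnorm n (sc_res \<sigma> R n M L A s L))\<^sup>2 \<le> \<sigma>\<^sup>2 * exp (-2 * R) *
     (1 + exp (R / (1 - 2 * R / L)) * (\<delta>0 + 2 * R / (1 - 2 * R / L) * (\<Sum>l<L. g l / 2 + e l) / L))\<^sup>2"
proof -
  define \<eta> where "\<eta> = 2 * R / L"
  define h where "h = \<eta> / (1 - \<eta>)"
  have L: "real L > 0" using assms by linarith
  have \<eta>: "0 < \<eta>" "\<eta> \<le> 1/2" using assms L by (auto simp: \<eta>_def field_simps)
  have h: "0 \<le> h" "h \<le> 1" using \<eta> by (auto simp: h_def field_simps)
  \<comment> \<open>The rate ties \<open>ln M\<close> to \<open>n\<close>, so the coefficient of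
    step \<open>l\<close> becomes \<open>sqrt \<eta> * \<tau> l\<close>.\<close>
  have lnM: "2 * ln M = n * \<eta>" using rate L by (simp add: \<eta>_def field_simps)
  define r where "r = sc_res \<sigma> R n M L A s"
  \<comment> \<open>The residual norm under ideal behaviour: with \<open>g = e = 0\<close>, the
    value \<open>u = 1\<close> reproduces itself in the step below.\<close>
  define \<tau> where "\<tau> l = sqrt n * \<sigma> * sqrt ((1 - \<eta>) ^ l)" for l
  have \<tau>0: "\<tau> l > 0" for l using assms \<eta> by (simp add: \<tau>_def)
  have \<tau>2: "(\<tau> l)\<^sup>2 = n * \<sigma>\<^sup>2 * (1 - \<eta>) ^ l" for l
    using \<eta> by (simp add: \<tau>_def power_mult_distrib)
  define u where "u l = vnorm n (r l) / \<tau> l" for l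
  have u0: "0 \<le> u l" for l unfolding u_def using \<tau>0[of l] vnorm_nonneg[of n "r l"] by simp
  have step: "(u (Suc l))\<^sup>2 \<le> (u l)\<^sup>2 + h * ((u l - 1)\<^sup>2 + g l + 2 * u l * e l)" if l: "l < L" for l
  proof -
    let ?m = "sc_select n M A (r l) l"
    define c where "c = sc_coef \<sigma> R M L l"
    have c: "c = sqrt \<eta> * \<tau> l"
      using assms(3) \<eta> by (simp add: c_def sc_coef_def \<tau>_def lnM real_sqrt_mult) (simp add: \<eta>_def)
    have c0: "c \<ge> 0" using c \<tau>0[of l] \<eta> by simp
    have nu: "vnorm n (r l) = u l * \<tau> l" using \<tau>0[of l] by (simp add: u_def)
    \<comment> \<open>Multiplied by the residual norm, the score bound also holds at a zero
      residual, where both sides are 0.\<close>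
    have sc: "sqrt (n * \<eta>) * (1 - e l) * (u l * \<tau> l) \<le> sc_score n A (r l) ?m * (u l * \<tau> l)"
    proof (cases "vnorm n (r l) = 0")
      case True
      then have "u l * \<tau> l = 0" using nu by linarith
      then show ?thesis by (simp only: mult_zero_right order_refl)
    next
      case False
      then show ?thesis using e[OF l] vnorm_nonneg[of n "r l"]
        unfolding lnM r_def[symmetric] nu[symmetric] by (intro mult_right_mono) auto
    qed
    have "(vnorm n (r (Suc l)))\<^sup>2 = (vnorm n (r l))\<^sup>2
        - 2 * c * vnorm n (r l) * sc_score n A (r l) ?m / sqrt n + c\<^sup>2 * (\<Sum>i<n. (A i ?m)\<^sup>2)"
      using vnorm_step[OF assms(1), of "r l" c A ?m] by (simp add: r_def c_def Let_def)
    also have "\<dots> \<le> (u l * \<tau> l)\<^sup>2 - 2 * c * (sqrt (n * \<eta>) * (1 - e l) * (u l * \<tau> l)) / sqrt n + c\<^sup>2 * (1 + g l)"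
    proof -
      have "2 * c / sqrt n * (sqrt (n * \<eta>) * (1 - e l) * (u l * \<tau> l)) \<le>
            2 * c / sqrt n * (sc_score n A (r l) ?m * (u l * \<tau> l))"
        using sc c0 by (intro mult_left_mono) auto
      moreover have "c\<^sup>2 * (\<Sum>i<n. (A i ?m)\<^sup>2) \<le> c\<^sup>2 * (1 + g l)"
        using g[OF l] by (intro mult_left_mono) (auto simp: r_def)
      ultimately show ?thesis by (simp add: nu mult_ac)
    qed
    also have "\<dots> = (\<tau> l)\<^sup>2 * ((u l)\<^sup>2 - 2 * \<eta> * (1 - e l) * u l + \<eta> * (1 + g l))"
    proof -
      have "c * sqrt (n * \<eta>) / sqrt n = \<eta> * \<tau> l"
        using assms(1) \<eta> by (simp add: c real_sqrt_mult)
      moreover have "2 * c * (sqrt (n * \<eta>) * (1 - e l) * (u l * \<tau> l)) / sqrt n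
        = 2 * (c * sqrt (n * \<eta>) / sqrt n) * (1 - e l) * (u l * \<tau> l)" by simp
      ultimately have "2 * c * (sqrt (n * \<eta>) * (1 - e l) * (u l * \<tau> l)) / sqrt n
        = 2 * (\<eta> * \<tau> l) * (1 - e l) * (u l * \<tau> l)" by simp
      moreover have "c\<^sup>2 = \<eta> * (\<tau> l)\<^sup>2" using \<eta> by (simp add: c power_mult_distrib)
      ultimately show ?thesis by (simp add: power2_eq_square algebra_simps)
    qed
    finally have "(u (Suc l))\<^sup>2 * (\<tau> (Suc l))\<^sup>2 \<le> \<dots>"
      using \<tau>0[of "Suc l"] by (simp add: u_def power_divide)
    moreover have "(\<tau> (Suc l))\<^sup>2 = (\<tau> l)\<^sup>2 * (1 - \<eta>)" by (simp add: \<tau>2)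
    ultimately have "(\<tau> l)\<^sup>2 * ((u (Suc l))\<^sup>2 * (1 - \<eta>))
        \<le> (\<tau> l)\<^sup>2 * ((u l)\<^sup>2 - 2 * \<eta> * (1 - e l) * u l + \<eta> * (1 + g l))"
      by (simp add: mult_ac)
    then have "(u (Suc l))\<^sup>2 * (1 - \<eta>) \<le> (u l)\<^sup>2 - 2 * \<eta> * (1 - e l) * u l + \<eta> * (1 + g l)"
      using \<tau>0[of l] by (simp add: mult_le_cancel_left)
    \<comment> \<open>By \<open>h * (1 - \<eta>) = \<eta>\<close>, the \<open>\<eta> * u^2\<close>
      inside the completed square cancels the loss from the factor
      \<open>1 - \<eta>\<close>.\<close>
    also have "\<dots> = ((u l)\<^sup>2 + h * ((u l - 1)\<^sup>2 + g l + 2 * u l * e l)) * (1 - \<eta>)"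
      using \<eta> by (simp add: h_def field_simps power2_eq_square)
    finally show ?thesis using \<eta> by simp
  qed
  have "u L \<le> 1 + (1 + h/2) ^ L * (\<delta>0 + h * (\<Sum>k<L. g k / 2 + e k))"
  proof (rule deviation_recursion[where u = u and g = g and e = e and L = L])
    show "u 0 \<le> 1 + \<delta>0" using assms(1,3,8) by (simp add: u_def \<tau>_def r_def field_simps)
  qed (use u0 h assms step in auto)
  also have "h = 2 * R / (1 - 2 * R / L) / L" by (simp add: h_def \<eta>_def)
  also have "(1 + 2 * R / (1 - 2 * R / L) / L / 2) ^ L \<le> exp (R / (1 - 2 * R / L))"
  proof -
    have "(1 + h/2) ^ L \<le> exp (h/2) ^ L"
      using h by (intro power_mono exp_ge_add_one_self) auto
    also have "\<dots> = exp (R / (1 - 2 * R / L))"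
      using L by (simp add: exp_of_nat_mult[symmetric] h_def \<eta>_def)
    finally show ?thesis by (simp add: h_def \<eta>_def mult_ac)
  qed
  finally have uL: "u L \<le> 1 + exp (R / (1 - 2 * R / L)) * (\<delta>0 + 2 * R / (1 - 2 * R / L) * (\<Sum>l<L. g l / 2 + e l) / L)"
    (is "_ \<le> ?B")
    using assms(4,7) L \<eta> ge by (simp add: \<eta>_def mult_right_mono sum_nonneg)
  have "1 / n * (vnorm n (r L))\<^sup>2 = 1 / n * (u L * \<tau> L)\<^sup>2"
    using \<tau>0[of L] by (simp add: u_def)
  also have "\<dots> = \<sigma>\<^sup>2 * (1 - \<eta>) ^ L * (u L)\<^sup>2"
    using assms(1) by (simp add: power_mult_distrib \<tau>2)
  also have "\<dots> \<le> \<sigma>\<^sup>2 * exp (-2 * R) * ?B\<^sup>2"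
  proof (intro mult_mono power_mono uL u0)
    have "(1 - \<eta>) ^ L \<le> exp (-\<eta>) ^ L"
      using \<eta> exp_ge_add_one_self[of "-\<eta>"] by (intro power_mono) auto
    also have "\<dots> = exp (-2 * R)" using L by (simp add: exp_of_nat_mult[symmetric] \<eta>_def)
    finally show "(1 - \<eta>) ^ L \<le> exp (-2 * R)" .
  qed (use \<eta> assms(3) in auto)
  finally show ?thesis unfolding r_def .
qed

section \<open>Maxima of Gaussian scores\<close>

text \<open>The relative deficit \<open>x = 1 - score_threshold M / sqrt (2 ln M)\<close> is chosen so that \<open>M^x = 4 ln M\<close>.\<close>

definition score_threshold :: "nat \<Rightarrow> real" where
  "score_threshold M = sqrt (2 * ln M) * (1 - ln (4 * ln M) / ln M)"

text \<open>The exponential will bound the probability that \<open>M - 1\<close> independent scores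
  all miss the threshold. By the choice of threshold the density is of order
  \<open>(ln M)^2 / M\<close>, so the exponent grows like \<open>(ln M) powr (3/2)\<close> and beats
  \<open>M powr (5/4)\<close>. The proof works in the variable \<open>y = ln M\<close>.\<close>

lemma gaussian_max_threshold_tail:
  "\<forall>\<^sub>F M in sequentially. M powr (5/4) *
     exp (- (real (M - 1) * (1 / sqrt (2 * ln M) *
       std_normal_density (score_threshold M + 1 / sqrt (2 * ln M))))) \<le> 4 * ln M"
proof -
  \<comment> \<open>The first fact bounds half the square of threshold plus interval width; the
    second is the comparison of \<open>y\<close> with \<open>y powr (3/2)\<close>; the third gives
    \<open>M - 1 \<ge> M / 2\<close>.\<close>
  have 1: "\<forall>\<^sub>F y :: real in at_top. y * (1 - ln (4*y) / y)\<^sup>2 + (1 - ln (4*y) / y) + 1 / (4*y)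
     \<le> y - 2 * ln (4*y) + 2" by real_asymp
  have 2: "\<forall>\<^sub>F y :: real in at_top. 5/4 * y \<le> (1/2) * (1 / sqrt (2*y)) * (1 / sqrt (2*pi)) * (16 * y\<^sup>2 * exp (-2))"
    by real_asymp
  have 3: "\<forall>\<^sub>F y :: real in at_top. exp y \<ge> 2" by real_asymp
  have 4: "\<forall>\<^sub>F y :: real in at_top. y \<ge> 1" by (rule eventually_ge_at_top)
  have lnM: "filterlim (\<lambda>M::nat. ln (real M)) at_top sequentially" by real_asymp
  have ev: "\<forall>\<^sub>F y in at_top.
     exp (y * (5/4)) * exp (- ((exp y - 1) * (1 / sqrt (2 * y) *
       std_normal_density (sqrt (2*y) * (1 - ln (4*y) / y) + 1 / sqrt (2 * y))))) \<le> 4 * y"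
    using 1 2 3 4
  proof eventually_elim
    case (elim y)
    let ?z = "ln (4*y) / y" and ?d = "1 / sqrt (2*y)"
    have y: "y \<ge> 1" using elim by simp
    have "(s * w + 1 / s)\<^sup>2 = s\<^sup>2 * w\<^sup>2 + 2 * w + 1 / s\<^sup>2" if "s > 0" for s w :: real
      using that by (simp add: power2_eq_square field_simps)
    from this[of "sqrt (2*y)" "1 - ?z"]
    have "(sqrt (2*y) * (1 - ?z) + ?d)\<^sup>2 = 2*y * (1 - ?z)\<^sup>2 + 2 * (1 - ?z) + 1/(2*y)"
      using y by simp
    then have "(sqrt (2*y) * (1 - ?z) + ?d)\<^sup>2 / 2 \<le> y - 2 * ln (4*y) + 2"
      using elim(1) by (simp add: field_simps)
    then have "exp (- (y - 2 * ln (4*y) + 2)) \<le> exp (- (sqrt (2*y) * (1 - ?z) + ?d)\<^sup>2 / 2)"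
      by simp
    moreover have "exp (- (y - 2 * ln (4*y) + 2)) = exp (-y) * (16 * y\<^sup>2 * exp (-2))"
    proof -
      have "- (y - 2 * ln (4*y) + 2) = -y + ((ln (4*y) + ln (4*y)) + -2)" by simp
      then have "exp (- (y - 2 * ln (4*y) + 2)) = exp (-y) * ((exp (ln (4*y)) * exp (ln (4*y))) * exp (-2))"
        by (metis exp_add)
      then show ?thesis using y by (simp add: power2_eq_square)
    qed
    ultimately have "exp (-y) * (16 * y\<^sup>2 * exp (-2)) \<le> exp (- (sqrt (2*y) * (1 - ?z) + ?d)\<^sup>2 / 2)"
      by linarith
    then have "1 / sqrt (2*pi) * (exp (-y) * (16 * y\<^sup>2 * exp (-2)))
        \<le> std_normal_density (sqrt (2*y) * (1 - ?z) + ?d)"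
      unfolding std_normal_density_def by (intro mult_left_mono) auto
    then have "(exp y / 2) * (?d * (1 / sqrt (2*pi) * (exp (-y) * (16 * y\<^sup>2 * exp (-2)))))
        \<le> (exp y - 1) * (?d * std_normal_density (sqrt (2*y) * (1 - ?z) + ?d))"
      using elim(3) y by (intro mult_mono) auto
    moreover have "(exp y / 2) * (?d * (1 / sqrt (2*pi) * (exp (-y) * (16 * y\<^sup>2 * exp (-2)))))
       = (1/2) * ?d * (1 / sqrt (2*pi)) * (16 * y\<^sup>2 * exp (-2))"
      by (simp add: exp_minus field_simps)
    ultimately have "y * (5/4) \<le> (exp y - 1) * (?d * std_normal_density (sqrt (2*y) * (1 - ?z) + ?d))"
      using elim(2) by linarith
    then have "exp (y * (5/4)) * exp (- ((exp y - 1) * (?d * std_normal_density (sqrt (2*y) * (1 - ?z) + ?d)))) \<le> 1"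
      by (simp flip: exp_add)
    also have "\<dots> \<le> 4 * y" using y by simp
    finally show ?case .
  qed
  from eventually_compose_filterlim[OF ev lnM] have "\<forall>\<^sub>F M in sequentially.
     exp (ln (real M) * (5/4)) * exp (- ((exp (ln (real M)) - 1) * (1 / sqrt (2 * ln M) *
       std_normal_density (sqrt (2*ln M) * (1 - ln (4*ln M) / ln M) + 1 / sqrt (2 * ln M))))) \<le> 4 * ln M" .
  then show ?thesis using eventually_ge_at_top[of 2]
    by eventually_elim (simp add: score_threshold_def powr_def of_nat_diff mult.commute)
qed

text \<open>A point of the product space is undefined outside the index set; padding with zeros makes every entry
  of the matrix a measurable function of it.\<close>

definition entries :: "(nat \<times> nat) set \<Rightarrow> (nat \<times> nat \<Rightarrow> real) \<Rightarrow> nat \<Rightarrow> nat \<Rightarrow> real" where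
  "entries I a i j = (if (i, j) \<in> I then a (i, j) else 0)"

lemma measurable_entries [measurable]:
  "(\<lambda>a. entries I a i j) \<in> borel_measurable (PiM I (\<lambda>_. borel))"
  unfolding entries_def by (cases "(i, j) \<in> I") auto

section \<open>Measurability of scores, selections and residuals\<close>

lemma measurable_vnorm:
  assumes [measurable]: "\<And>i. Y i \<in> borel_measurable N"
  shows "(\<lambda>\<omega>. vnorm n (\<lambda>i. Y i \<omega>)) \<in> borel_measurable N"
  unfolding vnorm_def by measurable

lemma measurable_sc_score:
  assumes [measurable]: "\<And>i j. B i j \<in> borel_measurable N" "\<And>i. Y i \<in> borel_measurable N"
  shows "(\<lambda>\<omega>. sc_score n (\<lambda>i j. B i j \<omega>) (\<lambda>i. Y i \<omega>) j) \<in> borel_measurable N"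
  unfolding sc_score_def using measurable_vnorm[of Y N n, measurable] by measurable

lemma measurable_sc_select:
  assumes "\<And>i j. B i j \<in> borel_measurable N" "\<And>i. Y i \<in> borel_measurable N"
  shows "(\<lambda>\<omega>. sc_select n M (\<lambda>i j. B i j \<omega>) (\<lambda>i. Y i \<omega>) l) \<in> measurable N (count_space UNIV)"
proof -
  note [measurable] = measurable_sc_score[OF assms]
  show ?thesis unfolding sc_select_def by measurable
qed

lemma measurable_sc_res:
  assumes [measurable]: "\<And>i j. B i j \<in> borel_measurable N" "\<And>i. Y i \<in> borel_measurable N"
  shows "(\<lambda>\<omega>. sc_res \<sigma> R n M L (\<lambda>i j. B i j \<omega>) (\<lambda>i. Y i \<omega>) l i) \<in> borel_measurable N"
proof (induction l arbitrary: i)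
  case 0
  then show ?case by simp
next
  case (Suc l)
  note IH = Suc.IH
  \<comment> \<open>The column index is itself random; since it takes countably many values, the
    entry at that index is still measurable.\<close>
  have sel: "(\<lambda>\<omega>. B i (sc_select n M (\<lambda>i j. B i j \<omega>) (sc_res \<sigma> R n M L (\<lambda>i j. B i j \<omega>) (\<lambda>i. Y i \<omega>) l) l) \<omega>)
      \<in> borel_measurable N"
    using measurable_sc_select[of B N "\<lambda>i \<omega>. sc_res \<sigma> R n M L (\<lambda>i j. B i j \<omega>) (\<lambda>i. Y i \<omega>) l i" n M l, OF assms(1) IH]
    by (rule measurable_compose_countable[rotated]) (rule assms(1))
  show ?case unfolding sc_res.simps Let_def
    by (intro borel_measurable_diff borel_measurable_times borel_measurable_const IH sel)
qed

text \<open>An upper bound for \<open>M\<close> raised to the score deficit (for a large enough section) that does not mention the maximizer: if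
  some score reaches the threshold, the first summand suffices, and otherwise the deficit is at most the one of the first
  column. A vanishing residual is treated separately because its scores are zero by the convention \<open>x / 0 = 0\<close>.\<close>

definition section_weight :: "nat \<Rightarrow> nat \<Rightarrow> (nat \<Rightarrow> nat \<Rightarrow> real) \<Rightarrow> (nat \<Rightarrow> real) \<Rightarrow> nat \<Rightarrow> real" where
  "section_weight n M A r l = (if vnorm n r = 0 then 1 else
     4 * ln M + M * exp (- sqrt (2 * ln M) / 2 * sc_score n A r (l * M)) *
       (\<Prod>j\<in>{l * M..<Suc l * M}. indicator {..<score_threshold M} (sc_score n A r j)))"

text \<open>Clipping at 0 gives the nonnegativity that \<open>deviation_recursion\<close> asks of
  \<open>e\<close>. The value 0 at a zero residual is consistent with
  \<open>sc_distortion_bound\<close>, which asks for a score bound at nonzero residuals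
  only.\<close>

definition score_deficit :: "nat \<Rightarrow> nat \<Rightarrow> (nat \<Rightarrow> nat \<Rightarrow> real) \<Rightarrow> (nat \<Rightarrow> real) \<Rightarrow> nat \<Rightarrow> real" where
  "score_deficit n M A r l = (if vnorm n r = 0 then 0 else
     max 0 (1 - sc_score n A r (sc_select n M A r l) / sqrt (2 * ln M)))"

lemma measurable_section_weight:
  assumes "\<And>i j. B i j \<in> borel_measurable N" "\<And>i. Y i \<in> borel_measurable N"
  shows "(\<lambda>\<omega>. section_weight n M (\<lambda>i j. B i j \<omega>) (\<lambda>i. Y i \<omega>) l) \<in> borel_measurable N"
proof -
  note [measurable] = measurable_sc_score[OF assms] measurable_vnorm[of Y N n, OF assms(2)]
  show ?thesis unfolding section_weight_def by measurable
qed

lemma section_weight_nonneg: "M \<ge> 1 \<Longrightarrow> 0 \<le> section_weight n M A r l"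
  by (auto simp: section_weight_def intro!: add_nonneg_nonneg mult_nonneg_nonneg prod_nonneg)

section \<open>Conditioning through product laws\<close>

text \<open>Turns independence of generated sigma-algebras, the form in which source and matrix are
  independent, into a product law; agreement on rectangles suffices.\<close>

lemma (in prob_space) distr_pair_indep_set:
  assumes X [measurable]: "X \<in> measurable M S" and Y [measurable]: "Y \<in> measurable M T"
    and indep: "indep_set (sets (vimage_algebra (space M) X S)) (sets (vimage_algebra (space M) Y T))"
  shows "distr M (S \<Otimes>\<^sub>M T) (\<lambda>\<omega>. (X \<omega>, Y \<omega>)) = distr M S X \<Otimes>\<^sub>M distr M T Y"
proof -
  interpret X: prob_space "distr M S X" by (rule prob_space_distr) fact
  interpret Y: prob_space "distr M T Y" by (rule prob_space_distr) fact
  have "distr M S X \<Otimes>\<^sub>M distr M T Y = distr M (S \<Otimes>\<^sub>M T) (\<lambda>\<omega>. (X \<omega>, Y \<omega>))"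
  proof (rule pair_measure_eqI)
    fix A B assume "A \<in> sets (distr M S X)" "B \<in> sets (distr M T Y)"
    then have AB [measurable]: "A \<in> sets S" "B \<in> sets T" by auto
    have "(\<lambda>\<omega>. (X \<omega>, Y \<omega>)) -` (A \<times> B) \<inter> space M = (X -` A \<inter> space M) \<inter> (Y -` B \<inter> space M)"
      by auto
    moreover have "prob ((X -` A \<inter> space M) \<inter> (Y -` B \<inter> space M))
        = prob (X -` A \<inter> space M) * prob (Y -` B \<inter> space M)"
      by (rule indep_setD[OF indep]) (auto intro: in_vimage_algebra AB)
    ultimately show "emeasure (distr M S X) A * emeasure (distr M T Y) B
        = emeasure (distr M (S \<Otimes>\<^sub>M T) (\<lambda>\<omega>. (X \<omega>, Y \<omega>))) (A \<times> B)"
      by (simp add: emeasure_distr emeasure_eq_measure ennreal_mult'')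
  qed (auto simp: X.sigma_finite_measure_axioms Y.sigma_finite_measure_axioms cong: sets_pair_measure_cong)
  then show ?thesis ..
qed

text \<open>Conditioning on \<open>Z\<close> as an instance of Tonelli's theorem: with
  \<open>Z\<close> frozen the inner integral is at most \<open>C\<close>. It serves both for the
  earlier sections and for the source.\<close>

lemma (in prob_space) nn_integral_pair_indep_le:
  assumes [measurable]: "random_variable N Z" "random_variable K W"
    and eq: "distr M (N \<Otimes>\<^sub>M K) (\<lambda>\<omega>. (Z \<omega>, W \<omega>)) = distr M N Z \<Otimes>\<^sub>M distr M K W"
    and [measurable]: "f \<in> borel_measurable N" "g \<in> borel_measurable (N \<Otimes>\<^sub>M K)"
    and C: "\<And>z. z \<in> space N \<Longrightarrow> (\<integral>\<^sup>+\<omega>. g (z, W \<omega>) \<partial>M) \<le> C"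
  shows "(\<integral>\<^sup>+\<omega>. f (Z \<omega>) * g (Z \<omega>, W \<omega>) \<partial>M) \<le> C * (\<integral>\<^sup>+\<omega>. f (Z \<omega>) \<partial>M)"
proof -
  interpret W: prob_space "distr M K W" by (rule prob_space_distr) fact
  have "(\<integral>\<^sup>+\<omega>. f (Z \<omega>) * g (Z \<omega>, W \<omega>) \<partial>M)
      = (\<integral>\<^sup>+x. f (fst x) * g x \<partial>distr M (N \<Otimes>\<^sub>M K) (\<lambda>\<omega>. (Z \<omega>, W \<omega>)))"
    by (subst nn_integral_distr) auto
  also have "\<dots> = (\<integral>\<^sup>+z. \<integral>\<^sup>+w. f z * g (z, w) \<partial>distr M K W \<partial>distr M N Z)"
    unfolding eq by (subst W.nn_integral_fst[symmetric]) auto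
  also have "\<dots> = (\<integral>\<^sup>+z. f z * (\<integral>\<^sup>+\<omega>. g (z, W \<omega>) \<partial>M) \<partial>distr M N Z)"
    by (intro nn_integral_cong) (simp add: nn_integral_cmult nn_integral_distr)
  also have "\<dots> \<le> (\<integral>\<^sup>+z. f z * C \<partial>distr M N Z)"
    by (intro nn_integral_mono mult_left_mono C) auto
  also have "\<dots> = C * (\<integral>\<^sup>+\<omega>. f (Z \<omega>) \<partial>M)"
    by (simp add: nn_integral_cmult nn_integral_distr mult.commute[of _ C])
  finally show ?thesis .
qed

section \<open>Gaussian integrals and the law of the scores\<close>

text \<open>The density decreases on the positive axis, so \<open>{a..a+\<delta>}\<close> has mass
  at least \<delta> times the density at its right end; then
  \<open>1 - x \<le> exp (- x)\<close>.\<close>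

lemma std_normal_below:
  assumes "0 \<le> a" "0 \<le> \<delta>"
  shows "(\<integral>\<^sup>+x. ennreal (std_normal_density x) * indicator {..<a} x \<partial>lborel)
     \<le> ennreal (exp (- (\<delta> * std_normal_density (a + \<delta>))))"
proof -
  define N where "N = density lborel std_normal_density"
  interpret prob_space N unfolding N_def by (rule prob_space_normal_density) simp
  have [simp]: "sets N = sets borel" "space N = UNIV" by (auto simp: N_def)
  have "ennreal (\<delta> * std_normal_density (a + \<delta>))
      = (\<integral>\<^sup>+x. ennreal (std_normal_density (a + \<delta>)) * indicator {a..a+\<delta>} x \<partial>lborel)"
    using assms by (simp add: nn_integral_cmult_indicator ennreal_mult' mult.commute)
  also have "\<dots> \<le> (\<integral>\<^sup>+x. ennreal (std_normal_density x) * indicator {a..a+\<delta>} x \<partial>lborel)"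
    using assms by (intro nn_integral_mono)
      (auto simp: indicator_def std_normal_density_def intro!: ennreal_leI divide_right_mono power_mono)
  also have "\<dots> = emeasure N {a..a+\<delta>}" by (simp add: N_def emeasure_density)
  finally have "\<delta> * std_normal_density (a + \<delta>) \<le> prob {a..a+\<delta>}"
    by (simp add: emeasure_eq_measure)
  also have "\<dots> \<le> prob (UNIV - {..<a})" by (intro finite_measure_mono) auto
  also have "\<dots> = 1 - prob {..<a}" using prob_compl[of "{..<a}"] by simp
  finally have "prob {..<a} \<le> 1 + - (\<delta> * std_normal_density (a + \<delta>))" by simp
  also have "\<dots> \<le> exp (- (\<delta> * std_normal_density (a + \<delta>)))" by (rule exp_ge_add_one_self)
  finally have "emeasure N {..<a} \<le> ennreal (exp (- (\<delta> * std_normal_density (a + \<delta>))))"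
    by (simp add: emeasure_eq_measure)
  then show ?thesis by (simp add: N_def emeasure_density)
qed

text \<open>Completing the square: the exponential weight shifts the mean to
  \<open>c\<close>.\<close>

lemma std_normal_exp_moment:
  "(\<integral>\<^sup>+x. ennreal (std_normal_density x) * ennreal (exp (c * x)) \<partial>lborel) = ennreal (exp (c\<^sup>2 / 2))"
proof -
  interpret prob_space "density lborel (normal_density c 1)" by (rule prob_space_normal_density) simp
  have *: "std_normal_density x * exp (c * x) = exp (c\<^sup>2/2) * normal_density c 1 x" for x
  proof -
    have "-x\<^sup>2/2 + c * x = c\<^sup>2/2 + -(x - c)\<^sup>2/2" by (simp add: power2_diff field_simps)
    then have "exp (-x\<^sup>2/2) * exp (c * x) = exp (c\<^sup>2/2) * exp (-(x - c)\<^sup>2/2)"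
      by (simp only: exp_add[symmetric])
    then show ?thesis by (simp add: normal_density_def mult.commute)
  qed
  have "(\<integral>\<^sup>+x. ennreal (normal_density c 1 x) \<partial>lborel) = 1"
    using emeasure_space_1 by (simp add: emeasure_density)
  moreover have "ennreal (std_normal_density x) * ennreal (exp (c * x))
      = ennreal (exp (c\<^sup>2/2)) * ennreal (normal_density c 1 x)" for x
    unfolding ennreal_mult'[OF normal_density_nonneg, symmetric] * by (rule ennreal_mult') simp
  ultimately show ?thesis by (simp add: nn_integral_cmult)
qed

text \<open>The weight turns the density into a normal one of variance
  \<open>\<tau>^2 / (1 - \<theta>)\<close>, up to the ratio of the standard deviations.\<close>

lemma normal_square_exp_moment:
  assumes "\<tau> > 0" "\<theta> < 1"
  shows "(\<integral>\<^sup>+x. ennreal (normal_density 0 \<tau> x) * ennreal (exp (\<theta> / 2 * (x\<^sup>2 / \<tau>\<^sup>2))) \<partial>lborel)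
    = ennreal (1 / sqrt (1 - \<theta>))"
proof -
  let ?t = "\<tau> / sqrt (1 - \<theta>)"
  interpret prob_space "density lborel (normal_density 0 ?t)"
    using assms by (intro prob_space_normal_density) simp
  have *: "normal_density 0 \<tau> x * exp (\<theta> / 2 * (x\<^sup>2 / \<tau>\<^sup>2)) = 1 / sqrt (1 - \<theta>) * normal_density 0 ?t x" for x
  proof -
    have "- x\<^sup>2 / (2 * \<tau>\<^sup>2) + \<theta> / 2 * (x\<^sup>2 / \<tau>\<^sup>2) = - x\<^sup>2 / (2 * ?t\<^sup>2)"
    proof -
      have "(?t)\<^sup>2 = \<tau>\<^sup>2 / (1 - \<theta>)" using assms by (simp add: power_divide)
      then show ?thesis using assms by (simp add: field_simps)
    qed
    then have "exp (- x\<^sup>2 / (2 * \<tau>\<^sup>2)) * exp (\<theta> / 2 * (x\<^sup>2 / \<tau>\<^sup>2)) = exp (- x\<^sup>2 / (2 * ?t\<^sup>2))"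
      by (simp only: exp_add[symmetric])
    moreover have "sqrt (2 * pi * ?t\<^sup>2) = sqrt (2 * pi * \<tau>\<^sup>2) / sqrt (1 - \<theta>)"
      using assms by (simp add: power_divide real_sqrt_divide)
    ultimately show ?thesis using assms by (simp add: normal_density_def)
  qed
  have "(\<integral>\<^sup>+x. ennreal (normal_density 0 ?t x) \<partial>lborel) = 1"
    using emeasure_space_1 by (simp add: emeasure_density)
  moreover have "ennreal (normal_density 0 \<tau> x) * ennreal (exp (\<theta> / 2 * (x\<^sup>2 / \<tau>\<^sup>2)))
      = ennreal (1 / sqrt (1 - \<theta>)) * ennreal (normal_density 0 ?t x)" for x
    unfolding ennreal_mult'[OF normal_density_nonneg, symmetric] *
    using assms by (intro ennreal_mult') simp
  ultimately show ?thesis by (simp add: nn_integral_cmult)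
qed

text \<open>For a fixed vector \<open>r\<close>, scores of different columns are functions of
  disjoint blocks of entries.\<close>

lemma (in prob_space) indep_scores:
  assumes "indep_vars (\<lambda>_. borel) (\<lambda>(i, j). A i j) ({..<n} \<times> J)"
  shows "indep_vars (\<lambda>_. borel) (\<lambda>j \<omega>. sc_score n (\<lambda>i j. A i j \<omega>) r j) J"
proof -
  have "indep_vars (\<lambda>j. PiM ({..<n} \<times> {j}) (\<lambda>_. borel))
     (\<lambda>j \<omega>. restrict (\<lambda>p. (case p of (i, j) \<Rightarrow> A i j) \<omega>) ({..<n} \<times> {j})) J"
    using assms by (rule indep_vars_restrict) (auto simp: disjoint_family_on_def)
  then have "indep_vars (\<lambda>_. borel) (\<lambda>j \<omega>. (\<lambda>a. \<Sum>i<n. (sqrt n * a (i, j)) * (r i / vnorm n r))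
     (restrict (\<lambda>p. (case p of (i, j) \<Rightarrow> A i j) \<omega>) ({..<n} \<times> {j}))) J"
    by (rule indep_vars_compose2) measurable
  then show ?thesis by (simp add: sc_score_def)
qed

text \<open>The score is a linear combination of independent normal entries, and dividing
  \<open>r\<close> by its norm makes the variances add up to 1.\<close>

lemma (in prob_space) score_normal:
  assumes "indep_vars (\<lambda>_. borel) (\<lambda>(i, j). A i j) ({..<n} \<times> {j})"
    and "\<And>i. i < n \<Longrightarrow> distributed M lborel (A i j) (normal_density 0 (sqrt (1 / n)))"
    and "vnorm n r \<noteq> 0"
  shows "distributed M lborel (\<lambda>\<omega>. sc_score n (\<lambda>i j. A i j \<omega>) r j) std_normal_density"
proof -
  \<comment> \<open>Coordinates with \<open>r i = 0\<close> are left out: a zero multiple of an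
    entry is constant and has no density.\<close>
  define I where "I = {i. i < n \<and> r i \<noteq> 0}"
  define \<alpha> where "\<alpha> i = sqrt n * (r i / vnorm n r)" for i
  have n: "n > 0" using assms(3) by (rule contrapos_np) (simp add: vnorm_def)
  have I: "finite I" "I \<noteq> {}"
  proof -
    show "I \<noteq> {}"
    proof
      assume "I = {}"
      then have "\<forall>i<n. r i = 0" by (auto simp: I_def)
      then show False using assms(3) by (simp add: vnorm_def)
    qed
  qed (simp add: I_def)
  have \<alpha>: "\<alpha> i \<noteq> 0" if "i \<in> I" for i using that n assms(3) by (simp add: \<alpha>_def I_def)
  have "indep_vars (\<lambda>i. PiM {(i, j)} (\<lambda>_. borel))
     (\<lambda>i \<omega>. restrict (\<lambda>p. (case p of (i, j) \<Rightarrow> A i j) \<omega>) {(i, j)}) I"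
    using assms(1) by (rule indep_vars_restrict) (auto simp: disjoint_family_on_def I_def)
  then have "indep_vars (\<lambda>_. borel) (\<lambda>i \<omega>. (\<lambda>a. 0 + \<alpha> i * a (i, j))
     (restrict (\<lambda>p. (case p of (i, j) \<Rightarrow> A i j) \<omega>) {(i, j)})) I"
    by (rule indep_vars_compose2) measurable
  then have indep: "indep_vars (\<lambda>_. borel) (\<lambda>i \<omega>. 0 + \<alpha> i * A i j \<omega>) I" by simp
  have "distributed M lborel (\<lambda>\<omega>. 0 + \<alpha> i * A i j \<omega>) (normal_density (0 + \<alpha> i * 0) (\<bar>\<alpha> i\<bar> * sqrt (1 / n)))"
    if "i \<in> I" for i
    using that n \<alpha> assms(2) by (intro normal_density_affine) (auto simp: I_def)
  from sum_indep_normal[OF I indep _ this] have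
    "distributed M lborel (\<lambda>\<omega>. \<Sum>i\<in>I. 0 + \<alpha> i * A i j \<omega>)
       (normal_density (\<Sum>i\<in>I. 0 + \<alpha> i * 0) (sqrt (\<Sum>i\<in>I. (\<bar>\<alpha> i\<bar> * sqrt (1 / n))\<^sup>2)))"
    using \<alpha> n by simp
  moreover have "(\<Sum>i\<in>I. (\<bar>\<alpha> i\<bar> * sqrt (1 / n))\<^sup>2) = 1"
  proof -
    have "(\<Sum>i\<in>I. (\<bar>\<alpha> i\<bar> * sqrt (1 / n))\<^sup>2) = (\<Sum>i\<in>I. (r i)\<^sup>2 / (vnorm n r)\<^sup>2)"
      using n by (intro sum.cong) (auto simp: \<alpha>_def power_mult_distrib power_divide)
    also have "\<dots> = (\<Sum>i<n. (r i)\<^sup>2 / (vnorm n r)\<^sup>2)"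
      by (intro sum.mono_neutral_left) (auto simp: I_def)
    also have "\<dots> = 1" using assms(3) by (simp add: sum_divide_distrib[symmetric] vnorm_sq[symmetric])
    finally show ?thesis .
  qed
  moreover have "(\<Sum>i\<in>I. \<alpha> i * A i j \<omega>) = sc_score n (\<lambda>i j. A i j \<omega>) r j" for \<omega>
  proof -
    have "(\<Sum>i\<in>I. \<alpha> i * A i j \<omega>) = (\<Sum>i<n. \<alpha> i * A i j \<omega>)"
      by (intro sum.mono_neutral_left) (auto simp: I_def \<alpha>_def)
    then show ?thesis by (simp add: sc_score_def \<alpha>_def mult_ac)
  qed
  ultimately show ?thesis by simp
qed

section \<open>Score deficits and their exponential moment\<close>

lemma score_deficit_nonneg: "0 \<le> score_deficit n M A r l"
  by (simp add: score_deficit_def)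

lemma score_deficit_le_section_weight:
  assumes "ln (real M) \<ge> 1"
  shows "M powr score_deficit n M A r l \<le> section_weight n M A r l"
proof (cases "vnorm n r = 0")
  case True
  then show ?thesis by (cases "M = 0") (auto simp: score_deficit_def section_weight_def)
next
  case False
  define y where "y = ln (real M)"
  define T where "T = sqrt (2 * y)"
  have y: "y \<ge> 1" using assms by (simp add: y_def)
  have M: "real M > 0" using assms by (cases M) auto
  have T: "T > 0" "T\<^sup>2 = 2 * y" using y by (auto simp: T_def)
  let ?m = "sc_select n M A r l" and ?S = "sc_score n A r"
  let ?x = "ln (4 * y) / y"
  have x0: "?x \<ge> 0" using y by simp
  have Mx: "M powr ?x = 4 * y" using y M by (simp add: powr_def y_def[symmetric])
  show ?thesis
  proof (cases "?S ?m \<ge> score_threshold M")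
    case True
    then have "T * (1 - ?x) \<le> ?S ?m" by (simp add: score_threshold_def T_def y_def)
    then have "1 - ?x \<le> ?S ?m / T" using T by (simp add: pos_le_divide_eq mult.commute)
    then have "score_deficit n M A r l \<le> ?x"
      using x0 by (simp add: score_deficit_def T_def y_def)
    then have "M powr score_deficit n M A r l \<le> M powr ?x"
      using y M by (intro powr_mono) (auto simp: y_def)
    also have "M powr ?x \<le> section_weight n M A r l"
      unfolding Mx using \<open>vnorm n r \<noteq> 0\<close> by (simp add: section_weight_def y_def prod_nonneg)
    finally show ?thesis .
  next
    case less: False
    have M0: "M > 0" using M by simp
    have le: "?S j \<le> ?S ?m" if "j \<in> {l * M..<Suc l * M}" for j
      using that sc_select_max[OF M0] by auto
    have "?S j < score_threshold M" if "j \<in> {l * M..<Suc l * M}" for j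
      using le[OF that] less by linarith
    then have "(\<Prod>j\<in>{l * M..<Suc l * M}. indicator {..<score_threshold M} (?S j)) = (1 :: real)"
      by (intro prod.neutral) (auto simp: indicator_def)
    then have w: "section_weight n M A r l = 4 * y + M * exp (- T / 2 * ?S (l * M))"
      using \<open>vnorm n r \<noteq> 0\<close> by (simp add: section_weight_def y_def T_def)
    have "score_deficit n M A r l \<le> max 0 (1 - ?S (l * M) / T)"
      using le[of "l * M"] M0 T \<open>vnorm n r \<noteq> 0\<close>
      by (auto simp: score_deficit_def T_def y_def max_def divide_right_mono intro: order_trans)
    then have "M powr score_deficit n M A r l \<le> M powr max 0 (1 - ?S (l * M) / T)"
      using y M by (intro powr_mono) (auto simp: y_def)
    \<comment> \<open>Removes the clipping; the extra 1 is absorbed by the summand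
      \<open>4 * y\<close>.\<close>
    also have "\<dots> \<le> M powr 0 + M powr (1 - ?S (l * M) / T)" by (simp add: max_def)
    also have "M powr (1 - ?S (l * M) / T) = exp (y + - T / 2 * ?S (l * M))"
    proof -
      have yT: "y / T = T / 2" using T by (simp add: field_simps power2_eq_square)
      have "(1 - ?S (l * M) / T) * y = y - (y / T) * ?S (l * M)"
        by (simp add: left_diff_distrib)
      then have "(1 - ?S (l * M) / T) * y = y + - T / 2 * ?S (l * M)" unfolding yT by simp
      then show ?thesis using M by (simp add: powr_def y_def)
    qed
    also have "\<dots> = M * exp (- T / 2 * ?S (l * M))"
      unfolding exp_add using M by (simp add: y_def)
    finally show ?thesis using y w M by simp
  qed
qed

text \<open>The locale uses \<open>M\<close> for the probability space, so the section size is
  \<open>N\<close>. For nonzero \<open>r\<close>, independence factorises the product: the first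
  column contributes at most \<open>N powr (1/4)\<close>, each other column the probability of
  missing the threshold. With the leading factor \<open>N\<close> this is the left side of
  \<open>tail\<close>, which adds at most \<open>4 * ln N\<close> to the deterministic
  \<open>4 * ln N\<close>.\<close>

lemma (in prob_space) section_weight_moment:
  assumes indep: "indep_vars (\<lambda>_. borel) (\<lambda>(i, j). A i j) ({..<n} \<times> {l * N..<Suc l * N})"
    and distr: "\<And>i j. i < n \<Longrightarrow> l * N \<le> j \<Longrightarrow> j < Suc l * N \<Longrightarrow>
       distributed M lborel (A i j) (normal_density 0 (sqrt (1 / n)))"
    and N: "ln (real N) \<ge> 1"
    and tail: "N powr (5/4) * exp (- (real (N - 1) * (1 / sqrt (2 * ln N) *
       std_normal_density (score_threshold N + 1 / sqrt (2 * ln N))))) \<le> 4 * ln N"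
    and thr: "score_threshold N \<ge> 0"
  shows "(\<integral>\<^sup>+\<omega>. ennreal (section_weight n N (\<lambda>i j. A i j \<omega>) r l) \<partial>M) \<le> ennreal (8 * ln N)"
proof (cases "vnorm n r = 0")
  case True
  then show ?thesis using N by (simp add: section_weight_def emeasure_space_1)
next
  case False
  define T where "T = sqrt (2 * ln N)"
  define J where "J = {l * N..<Suc l * N}"
  have N0: "N > 0" using N by (cases N) auto
  have J: "finite J" "l * N \<in> J" "card (J - {l * N}) = N - 1" using N0 by (auto simp: J_def)
  define S where "S j \<omega> = sc_score n (\<lambda>i j. A i j \<omega>) r j" for j \<omega>
  \<comment> \<open>The exponential is attached to the first column, so the random part becomes a
    product of functions of separate scores.\<close>
  define f :: "nat \<Rightarrow> real \<Rightarrow> ennreal" where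
    "f j x = (if j = l * N then ennreal (exp (- T / 2 * x)) else 1) * indicator {..<score_threshold N} x" for j x
  have f[measurable]: "f j \<in> borel_measurable borel" for j unfolding f_def by measurable
  have S: "distributed M lborel (S j) std_normal_density" if "j \<in> J" for j
    unfolding S_def using that False distr
    by (intro score_normal indep_vars_subset[OF indep]) (auto simp: J_def)
  have S_rv [measurable]: "S j \<in> borel_measurable M" if "j \<in> J" for j
    using distributed_measurable[OF S[OF that]] by simp
  have fS: "(\<integral>\<^sup>+\<omega>. f j (S j \<omega>) \<partial>M) = (\<integral>\<^sup>+x. ennreal (std_normal_density x) * f j x \<partial>lborel)" if "j \<in> J" for j
    using distributed_nn_integral[OF S[OF that], of "f j"] by simp
  have fS_indep: "indep_vars (\<lambda>_. borel) (\<lambda>j \<omega>. f j (S j \<omega>)) J"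
    using indep_scores[OF indep] unfolding S_def J_def by (rule indep_vars_compose2) (rule f)
  let ?q = "1 / T * std_normal_density (score_threshold N + 1 / T)"
  have "(\<integral>\<^sup>+\<omega>. (\<Prod>j\<in>J. f j (S j \<omega>)) \<partial>M) = (\<Prod>j\<in>J. \<integral>\<^sup>+\<omega>. f j (S j \<omega>) \<partial>M)"
    by (intro indep_vars_nn_integral J(1) fS_indep) auto
  also have "\<dots> = (\<integral>\<^sup>+\<omega>. f (l * N) (S (l * N) \<omega>) \<partial>M) * (\<Prod>j\<in>J - {l * N}. \<integral>\<^sup>+\<omega>. f j (S j \<omega>) \<partial>M)"
    using J by (intro prod.remove) auto
  also have "\<dots> \<le> ennreal (exp (T\<^sup>2 / 8)) * (\<Prod>j\<in>J - {l * N}. ennreal (exp (- ?q)))"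
  proof (intro mult_mono prod_mono_ennreal)
    \<comment> \<open>The indicator is dropped, leaving the exponential moment at
      \<open>c = - T / 2\<close>.\<close>
    have "(\<integral>\<^sup>+\<omega>. f (l * N) (S (l * N) \<omega>) \<partial>M) \<le> (\<integral>\<^sup>+x. ennreal (std_normal_density x) * ennreal (exp (- T / 2 * x)) \<partial>lborel)"
      unfolding fS[OF J(2)] by (intro nn_integral_mono mult_left_mono) (auto simp: f_def indicator_def)
    also have "\<dots> = ennreal (exp (T\<^sup>2 / 8))"
      unfolding std_normal_exp_moment by (simp add: power_divide)
    finally show "(\<integral>\<^sup>+\<omega>. f (l * N) (S (l * N) \<omega>) \<partial>M) \<le> ennreal (exp (T\<^sup>2 / 8))" .
  next
    fix j assume "j \<in> J - {l * N}"
    then have j: "j \<in> J" "j \<noteq> l * N" by auto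
    have "0 \<le> 1 / T" using N by (simp add: T_def)
    from std_normal_below[OF thr this] j(2)
    show "(\<integral>\<^sup>+\<omega>. f j (S j \<omega>) \<partial>M) \<le> ennreal (exp (- ?q))"
      unfolding fS[OF j(1)] by (simp add: f_def)
  qed auto
  also have "\<dots> = ennreal (N powr (1/4) * exp (- (real (N - 1) * ?q)))"
  proof -
    have "exp (T\<^sup>2 / 8) = N powr (1/4)" using N N0 by (simp add: T_def powr_def)
    moreover have "exp (- ?q) ^ (N - 1) = exp (- (real (N - 1) * ?q))"
      by (simp add: exp_of_nat_mult[symmetric])
    ultimately show ?thesis
      by (simp only: prod_constant J(3) ennreal_power exp_ge_zero) (simp add: ennreal_mult)
  qed
  finally have le: "(\<integral>\<^sup>+\<omega>. (\<Prod>j\<in>J. f j (S j \<omega>)) \<partial>M) \<le> \<dots>" .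
  have w: "ennreal (section_weight n N (\<lambda>i j. A i j \<omega>) r l)
      = ennreal (4 * ln N) + ennreal N * (\<Prod>j\<in>J. f j (S j \<omega>))" for \<omega>
  proof -
    have "(\<Prod>j\<in>J. f j (S j \<omega>)) = ennreal (exp (- T / 2 * S (l * N) \<omega>)) *
       (\<Prod>j\<in>J. indicator {..<score_threshold N} (S j \<omega>))"
      using J by (simp add: f_def prod.distrib prod.delta)
    also have "(\<Prod>j\<in>J. indicator {..<score_threshold N} (S j \<omega>)) =
      ennreal (\<Prod>j\<in>J. indicator {..<score_threshold N} (S j \<omega>))"
      by (subst prod_ennreal[symmetric]) (auto intro!: prod.cong simp: indicator_def)
    finally show ?thesis using False N
      by (simp add: section_weight_def S_def T_def J_def ennreal_mult ennreal_plus prod_nonneg mult.assoc)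
  qed
  have "(\<integral>\<^sup>+\<omega>. ennreal (section_weight n N (\<lambda>i j. A i j \<omega>) r l) \<partial>M)
     = ennreal (4 * ln N) + ennreal N * (\<integral>\<^sup>+\<omega>. (\<Prod>j\<in>J. f j (S j \<omega>)) \<partial>M)"
    unfolding w by (simp add: nn_integral_add nn_integral_cmult emeasure_space_1)
  also have "\<dots> \<le> ennreal (4 * ln N) + ennreal N * ennreal (N powr (1/4) * exp (- (real (N - 1) * ?q)))"
    by (intro add_left_mono mult_left_mono le) auto
  also have "\<dots> = ennreal (4 * ln N + N * (N powr (1/4) * exp (- (real (N - 1) * ?q))))"
    using N by (simp add: ennreal_mult ennreal_plus)
  also have "\<dots> \<le> ennreal (8 * ln N)"
  proof (rule ennreal_leI)
    have "real N * N powr (1/4) = N powr (5/4)"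
      using N0 powr_add[of "real N" 1 "1/4"] by simp
    then show "4 * ln N + N * (N powr (1/4) * exp (- (real (N - 1) * ?q))) \<le> 8 * ln N"
      using tail by (simp add: T_def mult.assoc[symmetric])
  qed
  finally show ?thesis .
qed

section \<open>Norms of the selected columns\<close>

text \<open>Chernoff bound: for an entry \<open>x\<close>, the mean of
  \<open>exp (\<theta> / 2 * (n * x^2 - 1))\<close> is
  \<open>exp (- \<theta> / 2) / sqrt (1 - \<theta>)\<close>, at most
  \<open>exp (\<theta>^2)\<close>. Independence multiplies this over \<open>n * card J\<close>
  entries.\<close>

lemma (in prob_space) column_norms_tail:
  fixes A :: "nat \<Rightarrow> 'b \<Rightarrow> 'a \<Rightarrow> real" and n :: nat and s \<theta> :: real
  assumes indep: "indep_vars (\<lambda>_. borel) (\<lambda>(i, j). A i j) ({..<n} \<times> J)"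
    and distr: "\<And>i j. i < n \<Longrightarrow> j \<in> J \<Longrightarrow> distributed M lborel (A i j) (normal_density 0 (sqrt (1 / n)))"
    and "finite J" "n > 0" "0 \<le> \<theta>" "\<theta> \<le> 1/2"
  shows "{\<omega> \<in> space M. s < (\<Sum>j\<in>J. (\<Sum>i<n. (A i j \<omega>)\<^sup>2) - 1)} \<in> events" (is "?E \<in> _")
    and "prob {\<omega> \<in> space M. s < (\<Sum>j\<in>J. (\<Sum>i<n. (A i j \<omega>)\<^sup>2) - 1)}
      \<le> exp (n / 2 * (2 * \<theta>\<^sup>2 * card J - \<theta> * s))"
proof -
  have [measurable]: "A i j \<in> borel_measurable M" if "i < n" "j \<in> J" for i j
    using distributed_measurable[OF distr[OF that]] by simp
  show E [measurable]: "?E \<in> events" by measurable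
  define I where "I = {..<n} \<times> J"
  have I: "finite I" "card I = n * card J" using assms(3) by (auto simp: I_def card_cartesian_product)
  define f :: "real \<Rightarrow> ennreal" where "f x = ennreal (exp (\<theta> / 2 * (real n * x\<^sup>2 - 1)))" for x :: real
  have f [measurable]: "f \<in> borel_measurable borel" unfolding f_def by measurable
  define B where "B p = (case p of (i, j) \<Rightarrow> A i j)" for p
  have B: "distributed M lborel (B p) (normal_density 0 (sqrt (1 / n)))" if "p \<in> I" for p
    using that distr by (auto simp: B_def I_def)
  have B_rv [measurable]: "B p \<in> borel_measurable M" if "p \<in> I" for p
    using distributed_measurable[OF B[OF that]] by simp
  have moment: "(\<integral>\<^sup>+\<omega>. f (B p \<omega>) \<partial>M) \<le> ennreal (exp (\<theta>\<^sup>2))" if "p \<in> I" for p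
  proof -
    have "(\<integral>\<^sup>+\<omega>. f (B p \<omega>) \<partial>M) = (\<integral>\<^sup>+x. ennreal (normal_density 0 (sqrt (1 / n)) x) * f x \<partial>lborel)"
      using distributed_nn_integral[OF B[OF that], of f] by simp
    also have "\<dots> = (\<integral>\<^sup>+x. ennreal (exp (- \<theta> / 2)) * (ennreal (normal_density 0 (sqrt (1 / n)) x) *
        ennreal (exp (\<theta> / 2 * (x\<^sup>2 / (sqrt (1 / n))\<^sup>2)))) \<partial>lborel)"
    proof (rule nn_integral_cong)
      fix x :: real
      have "\<theta> / 2 * (n * x\<^sup>2 - 1) = - \<theta> / 2 + \<theta> / 2 * (x\<^sup>2 / (sqrt (1 / n))\<^sup>2)"
        by (simp add: algebra_simps)
      then have "f x = ennreal (exp (- \<theta> / 2)) * ennreal (exp (\<theta> / 2 * (x\<^sup>2 / (sqrt (1 / n))\<^sup>2)))"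
        unfolding f_def by (simp only: exp_add ennreal_mult' exp_ge_zero)
      then show "ennreal (normal_density 0 (sqrt (1 / n)) x) * f x = ennreal (exp (- \<theta> / 2)) *
         (ennreal (normal_density 0 (sqrt (1 / n)) x) * ennreal (exp (\<theta> / 2 * (x\<^sup>2 / (sqrt (1 / n))\<^sup>2))))"
        by (simp only: mult.left_commute)
    qed
    also have "\<dots> = ennreal (exp (- \<theta> / 2)) * ennreal (1 / sqrt (1 - \<theta>))"
    proof -
      have "sqrt (1 / real n) > 0" "\<theta> < 1" using assms(4,6) by auto
      note moment = normal_square_exp_moment[OF this]
      show ?thesis by (subst nn_integral_cmult) (auto simp only: moment, measurable)
    qed
    also have "\<dots> = ennreal (exp (- \<theta> / 2) * (1 / sqrt (1 - \<theta>)))" by (rule ennreal_mult'[symmetric]) simp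
    also have "\<dots> \<le> ennreal (exp (\<theta>\<^sup>2))"
    proof (rule ennreal_leI)
      have "- ln (1 - \<theta>) / 2 = - ln (sqrt (1 - \<theta>))" using assms(6) by (simp add: ln_sqrt)
      moreover have "exp (- ln (sqrt (1 - \<theta>))) = 1 / sqrt (1 - \<theta>)"
      proof -
        have "sqrt (1 - \<theta>) > 0" using assms(6) by simp
        then show ?thesis by (simp only: exp_minus exp_ln inverse_eq_divide)
      qed
      ultimately have "1 / sqrt (1 - \<theta>) = exp (- ln (1 - \<theta>) / 2)" by (simp only:)
      \<comment> \<open>For \<theta> between 0 and \<open>1/2\<close>,
        \<open>- ln (1 - \<theta>) \<le> \<theta> + 2 * \<theta>^2\<close>; the linear term cancels
        against \<open>exp (- \<theta> / 2)\<close>.\<close>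
      also have "\<dots> \<le> exp ((\<theta> + 2 * \<theta>\<^sup>2) / 2)"
        using ln_one_minus_pos_lower_bound[of \<theta>] assms(5,6) by simp
      finally have "exp (- \<theta> / 2) * (1 / sqrt (1 - \<theta>)) \<le> exp (- \<theta> / 2) * exp ((\<theta> + 2 * \<theta>\<^sup>2) / 2)"
        by (intro mult_left_mono) auto
      also have "\<dots> = exp (\<theta>\<^sup>2)" by (simp add: exp_add[symmetric] add_divide_distrib)
      finally show "exp (- \<theta> / 2) * (1 / sqrt (1 - \<theta>)) \<le> exp (\<theta>\<^sup>2)" .
    qed
    finally show ?thesis .
  qed
  have indep_f: "indep_vars (\<lambda>_. borel) (\<lambda>p \<omega>. f (B p \<omega>)) I"
    using indep unfolding B_def I_def by (rule indep_vars_compose2) (rule f)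
  let ?c = "ennreal (exp (- (\<theta> / 2 * (n * s))))"
  have "emeasure M ?E = (\<integral>\<^sup>+\<omega>. indicator ?E \<omega> \<partial>M)" by simp
  also have "\<dots> \<le> (\<integral>\<^sup>+\<omega>. ?c * (\<Prod>p\<in>I. f (B p \<omega>)) \<partial>M)"
  proof (rule nn_integral_mono)
    fix \<omega>
    \<comment> \<open>Markov's inequality in pointwise form: on the event the combined exponent is
      nonnegative, so the right side is at least 1.\<close>
    show "indicator ?E \<omega> \<le> ?c * (\<Prod>p\<in>I. f (B p \<omega>))"
    proof (cases "\<omega> \<in> ?E")
      case True
      have "(\<Sum>p\<in>I. n * (B p \<omega>)\<^sup>2 - 1) = (\<Sum>i<n. \<Sum>j\<in>J. n * (A i j \<omega>)\<^sup>2 - 1)"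
        unfolding I_def B_def by (simp add: sum.cartesian_product case_prod_beta)
      also have "\<dots> = (\<Sum>j\<in>J. \<Sum>i<n. n * (A i j \<omega>)\<^sup>2 - 1)" by (rule sum.swap)
      also have "\<dots> = n * (\<Sum>j\<in>J. (\<Sum>i<n. (A i j \<omega>)\<^sup>2) - 1)"
        unfolding sum_distrib_left by (simp add: sum_subtractf sum_distrib_left right_diff_distrib)
      finally have eq: "(\<Sum>p\<in>I. n * (B p \<omega>)\<^sup>2 - 1) = n * (\<Sum>j\<in>J. (\<Sum>i<n. (A i j \<omega>)\<^sup>2) - 1)" .
      have "(\<Prod>p\<in>I. f (B p \<omega>)) = ennreal (exp (\<theta> / 2 * (\<Sum>p\<in>I. n * (B p \<omega>)\<^sup>2 - 1)))"
        unfolding f_def using I(1) by (simp add: prod_ennreal exp_sum[symmetric] sum_distrib_left)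
      then have "?c * (\<Prod>p\<in>I. f (B p \<omega>))
          = ennreal (exp (\<theta> / 2 * n * ((\<Sum>j\<in>J. (\<Sum>i<n. (A i j \<omega>)\<^sup>2) - 1) - s)))"
        unfolding eq by (simp add: ennreal_mult'[symmetric] exp_add[symmetric] right_diff_distrib)
      moreover have "0 \<le> \<theta> / 2 * n * ((\<Sum>j\<in>J. (\<Sum>i<n. (A i j \<omega>)\<^sup>2) - 1) - s)"
        using True assms(5) by (intro mult_nonneg_nonneg) auto
      ultimately show ?thesis using True by simp
    qed simp
  qed
  also have "\<dots> = ?c * (\<Prod>p\<in>I. \<integral>\<^sup>+\<omega>. f (B p \<omega>) \<partial>M)"
    using I(1) by (subst nn_integral_cmult) (auto simp: indep_vars_nn_integral[OF I(1) indep_f])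
  also have "\<dots> \<le> ?c * (\<Prod>p\<in>I. ennreal (exp (\<theta>\<^sup>2)))"
    by (intro mult_left_mono prod_mono_ennreal moment) auto
  also have "\<dots> = ennreal (exp (n / 2 * (2 * \<theta>\<^sup>2 * card J - \<theta> * s)))"
  proof -
    have "exp (- (\<theta> / 2 * (n * s))) * exp (\<theta>\<^sup>2) ^ (n * card J) = exp (n / 2 * (2 * \<theta>\<^sup>2 * card J - \<theta> * s))"
      by (simp add: exp_of_nat_mult[symmetric] exp_add[symmetric] algebra_simps)
    then show ?thesis
      by (simp only: prod_constant I(2) ennreal_power exp_ge_zero ennreal_mult'[symmetric])
  qed
  finally show "prob ?E \<le> exp (n / 2 * (2 * \<theta>\<^sup>2 * card J - \<theta> * s))"
    by (simp add: emeasure_eq_measure)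
qed

text \<open>The value \<open>f l = N\<close> encodes that no column is taken from section \<open>l\<close>.\<close>

lemma (in prob_space) selected_columns_tail:
  fixes A :: "nat \<Rightarrow> nat \<Rightarrow> 'a \<Rightarrow> real" and n N L :: nat and R t \<theta> :: real
  assumes indep: "indep_vars (\<lambda>_. borel) (\<lambda>(i, j). A i j) ({..<n} \<times> {..<N * L})"
    and distr: "\<And>i j. i < n \<Longrightarrow> j < N * L \<Longrightarrow> distributed M lborel (A i j) (normal_density 0 (sqrt (1 / n)))"
    and "n > 0" "0 \<le> \<theta>" "\<theta> \<le> 1/2" "N \<ge> 2" and rate: "real L * ln (real N) = n * R"
  defines "E \<equiv> (\<Union>f\<in>{..<L} \<rightarrow>\<^sub>E {..N}. {\<omega> \<in> space M.
      L * t < (\<Sum>l\<in>{l. l < L \<and> f l < N}. (\<Sum>i<n. (A i (l * N + f l) \<omega>)\<^sup>2) - 1)})"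
  shows "E \<in> events" and "prob E \<le> exp (n * (2 * R - L * \<theta> * (t - 2 * \<theta>) / 2))"
proof -
  let ?F = "{..<L} \<rightarrow>\<^sub>E {..N}"
  define G where "G f = {\<omega> \<in> space M.
      L * t < (\<Sum>l\<in>{l. l < L \<and> f l < N}. (\<Sum>i<n. (A i (l * N + f l) \<omega>)\<^sup>2) - 1)}" for f
  have F: "finite ?F" by (intro finite_PiE) auto
  have G: "G f \<in> events" "prob (G f) \<le> exp (n / 2 * (2 * \<theta>\<^sup>2 * L - \<theta> * (L * t)))" for f
  proof -
    define K where "K = {l. l < L \<and> f l < N}"
    define J where "J = (\<lambda>l. l * N + f l) ` K"
    have K: "finite K" "card K \<le> L"
      using card_mono[of "{..<L}" K] by (auto simp: K_def)
    \<comment> \<open>Division by \<open>N\<close> recovers the section because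
      \<open>f l < N\<close> on \<open>K\<close>.\<close>
    have inj: "inj_on (\<lambda>l. l * N + f l) K"
    proof (rule inj_on_inverseI)
      fix l assume "l \<in> K"
      then show "(l * N + f l) div N = l" by (simp add: K_def)
    qed
    have J: "finite J" "card J = card K" using K(1) inj by (auto simp: J_def card_image)
    have JL: "j < N * L" if "j \<in> J" for j
    proof -
      from that obtain l where l: "l < L" "f l < N" "j = l * N + f l" by (auto simp: J_def K_def)
      then have "j < Suc l * N" by simp
      also have "\<dots> \<le> L * N" using l(1) by (intro mult_le_mono1) simp
      finally show ?thesis by (simp add: mult.commute)
    qed
    have indep': "indep_vars (\<lambda>_. borel) (\<lambda>(i, j). A i j) ({..<n} \<times> J)"
      using indep by (rule indep_vars_subset) (auto dest: JL)
    have distr': "distributed M lborel (A i j) (normal_density 0 (sqrt (1 / n)))" if "i < n" "j \<in> J" for i j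
      using that JL distr by auto
    have G_eq: "G f = {\<omega> \<in> space M. L * t < (\<Sum>j\<in>J. (\<Sum>i<n. (A i j \<omega>)\<^sup>2) - 1)}"
      unfolding G_def J_def K_def[symmetric] by (simp add: sum.reindex[OF inj])
    note tail = column_norms_tail[OF indep' distr' J(1) assms(3,4,5), of "L * t"]
    show "G f \<in> events" unfolding G_eq by (rule tail(1))
    have "prob (G f) \<le> exp (n / 2 * (2 * \<theta>\<^sup>2 * card J - \<theta> * (L * t)))" unfolding G_eq by (rule tail(2))
    also have "\<dots> \<le> exp (n / 2 * (2 * \<theta>\<^sup>2 * L - \<theta> * (L * t)))"
      using K J by (simp add: mult_left_mono)
    finally show "prob (G f) \<le> exp (n / 2 * (2 * \<theta>\<^sup>2 * L - \<theta> * (L * t)))" .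
  qed
  have E: "E = (\<Union>f\<in>?F. G f)" by (simp add: E_def G_def)
  show "E \<in> events" unfolding E using F G(1) by auto
  have "prob E \<le> (\<Sum>f\<in>?F. prob (G f))"
    unfolding E using F G(1) by (intro finite_measure_subadditive_finite) auto
  also have "\<dots> \<le> (\<Sum>f\<in>?F. exp (n / 2 * (2 * \<theta>\<^sup>2 * L - \<theta> * (L * t))))"
    by (intro sum_mono G(2))
  also have "\<dots> = real (N + 1) ^ L * exp (n / 2 * (2 * \<theta>\<^sup>2 * L - \<theta> * (L * t)))"
    by (simp add: card_PiE)
  \<comment> \<open>The crude \<open>N + 1 \<le> N^2\<close> lets the rate express the number of
    choices as \<open>exp (2 * n * R)\<close>.\<close>
  also have "\<dots> \<le> (real N ^ 2) ^ L * exp (n / 2 * (2 * \<theta>\<^sup>2 * L - \<theta> * (L * t)))"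
  proof (intro mult_right_mono power_mono)
    have "2 * real N \<le> real N * real N" using assms(6) by (intro mult_right_mono) auto
    then show "real (N + 1) \<le> (real N)\<^sup>2"
      using assms(6) unfolding power2_eq_square by linarith
  qed auto
  also have "(real N ^ 2) ^ L = exp (n * (2 * R))"
  proof -
    have "(real N ^ 2) ^ L = exp (ln (real N)) ^ (2 * L)"
      using assms(6) by (simp add: power_mult)
    also have "\<dots> = exp (2 * (L * ln (real N)))" by (simp add: exp_of_nat_mult[symmetric])
    finally show ?thesis by (simp add: rate mult_ac)
  qed
  also have "exp (n * (2 * R)) * exp (n / 2 * (2 * \<theta>\<^sup>2 * L - \<theta> * (L * t))) = exp (n * (2 * R - L * \<theta> * (t - 2 * \<theta>) / 2))"
    by (simp add: exp_add[symmetric] algebra_simps power2_eq_square diff_divide_distrib)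
  finally show "prob E \<le> exp (n * (2 * R - L * \<theta> * (t - 2 * \<theta>) / 2))" .
qed

section \<open>Conditioning on the earlier sections\<close>

lemma section_weight_cong:
  assumes "M > 0" "\<And>i j. i < n \<Longrightarrow> l * M \<le> j \<Longrightarrow> j < Suc l * M \<Longrightarrow> A i j = A' i j"
    and "\<And>i. i < n \<Longrightarrow> r i = r' i"
  shows "section_weight n M A r l = section_weight n M A' r' l"
proof -
  have "sc_score n A r j = sc_score n A' r' j" if "l * M \<le> j" "j < Suc l * M" for j
    using that assms(2,3) by (intro sc_score_cong) auto
  then show ?thesis using vnorm_cong[of n r r', OF assms(3)] assms(1)
    by (simp add: section_weight_def)
qed

lemma measurable_section_weight_prod:
  assumes "\<And>i j. B i j \<in> borel_measurable N" "\<And>i. Y i \<in> borel_measurable N"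
  shows "(\<lambda>\<omega>. \<Prod>k<l. section_weight n M (\<lambda>i j. B i j \<omega>) 
      (\<lambda>i. sc_res \<sigma> R n M L (\<lambda>i j. B i j \<omega>) (\<lambda>i. Y i \<omega>) k i) k) \<in> borel_measurable N"
  by (intro borel_measurable_prod measurable_section_weight measurable_sc_res assms)

text \<open>Induction over sections: the earlier columns enter the weight of section
  \<open>l\<close> only through the residual, and \<open>C\<close> bounds its mean for every fixed
  vector, so each section costs one factor \<open>C\<close>.\<close>

lemma (in prob_space) section_weight_prod_moment_fixed:
  assumes indep: "indep_vars (\<lambda>_. borel) (\<lambda>(i, j). A i j) ({..<n} \<times> {..<N * L})"
    and "N > 0"
    and C: "\<And>l r. l < L \<Longrightarrow> (\<integral>\<^sup>+\<omega>. ennreal (section_weight n N (\<lambda>i j. A i j \<omega>) r l) \<partial>M) \<le> C"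
    and "l \<le> L"
  shows "(\<integral>\<^sup>+\<omega>. ennreal (\<Prod>k<l. section_weight n N (\<lambda>i j. A i j \<omega>)
      (sc_res \<sigma> R n N L (\<lambda>i j. A i j \<omega>) s k) k) \<partial>M) \<le> C ^ l"
  using assms(4)
proof (induction l)
  case 0
  then show ?case by (simp add: emeasure_space_1)
next
  case (Suc l)
  define I where "I = {..<n} \<times> {..<l * N}"
  define J where "J = {..<n} \<times> {l * N..<Suc l * N}"
  define Z where "Z \<omega> = restrict (\<lambda>p. (case p of (i, j) \<Rightarrow> A i j) \<omega>) I" for \<omega>
  define W where "W \<omega> = restrict (\<lambda>p. (case p of (i, j) \<Rightarrow> A i j) \<omega>) J" for \<omega>
  let ?A = "\<lambda>\<omega> i j. A i j \<omega>"
  have "Suc l * N \<le> N * L" using Suc.prems by (metis mult.commute mult_le_mono1)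
  then have "indep_var (PiM I (\<lambda>_. borel)) Z (PiM J (\<lambda>_. borel)) W"
    unfolding Z_def W_def by (intro indep_var_restrict[OF indep]) (auto simp: I_def J_def)
  then have ZW: "random_variable (PiM I (\<lambda>_. borel)) Z" "random_variable (PiM J (\<lambda>_. borel)) W"
    "distr M (PiM I (\<lambda>_. borel) \<Otimes>\<^sub>M PiM J (\<lambda>_. borel)) (\<lambda>\<omega>. (Z \<omega>, W \<omega>))
      = distr M (PiM I (\<lambda>_. borel)) Z \<Otimes>\<^sub>M distr M (PiM J (\<lambda>_. borel)) W"
    unfolding indep_var_distribution_eq by auto
  define f where "f z = ennreal (\<Prod>k<l. section_weight n N (entries I z)
      (sc_res \<sigma> R n N L (entries I z) s k) k)" for z
  define g where "g = (\<lambda>(z, w). ennreal (section_weight n N (entries J w)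
      (sc_res \<sigma> R n N L (entries I z) s l) l))"
  have f: "f \<in> borel_measurable (PiM I (\<lambda>_. borel))"
    unfolding f_def
    using measurable_section_weight_prod[of "\<lambda>i j z. entries I z i j" _ "\<lambda>i z. s i"] by simp
  have g: "g \<in> borel_measurable (PiM I (\<lambda>_. borel) \<Otimes>\<^sub>M PiM J (\<lambda>_. borel))"
  proof -
    have "(\<lambda>x. entries I (fst x) i j) \<in> borel_measurable (PiM I (\<lambda>_. borel) \<Otimes>\<^sub>M PiM J (\<lambda>_. borel))"
         "(\<lambda>x. entries J (snd x) i j) \<in> borel_measurable (PiM I (\<lambda>_. borel) \<Otimes>\<^sub>M PiM J (\<lambda>_. borel))" for i j
      by measurable
    then have "(\<lambda>x. section_weight n N (\<lambda>i j. entries J (snd x) i j)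
       (\<lambda>i. sc_res \<sigma> R n N L (\<lambda>i j. entries I (fst x) i j) (\<lambda>i. s i) l i) l)
       \<in> borel_measurable (PiM I (\<lambda>_. borel) \<Otimes>\<^sub>M PiM J (\<lambda>_. borel))"
      by (intro measurable_section_weight measurable_sc_res borel_measurable_const)
    then show ?thesis unfolding g_def case_prod_beta by simp
  qed
  have gW: "g (z, W \<omega>) = ennreal (section_weight n N (?A \<omega>) (sc_res \<sigma> R n N L (entries I z) s l) l)" for z \<omega>
    unfolding g_def using assms(2)
    by (auto intro!: arg_cong[where f = ennreal] section_weight_cong simp: entries_def W_def J_def)
  have gC: "(\<integral>\<^sup>+\<omega>. g (z, W \<omega>) \<partial>M) \<le> C" for z
    unfolding gW using Suc.prems by (intro C) simp
  note le = nn_integral_pair_indep_le[OF ZW f g gC]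
  have res: "sc_res \<sigma> R n N L (entries I (Z \<omega>)) s k i = sc_res \<sigma> R n N L (?A \<omega>) s k i"
    if "k \<le> l" "i < n" for k i \<omega>
  proof (rule sc_res_cong)
    fix i j assume "i < n" "j < k * N"
    moreover have "k * N \<le> l * N" using that(1) by (rule mult_le_mono1)
    ultimately have "i < n" "j < l * N" by linarith+
    then show "entries I (Z \<omega>) i j = A i j \<omega>" by (auto simp: entries_def Z_def I_def)
  qed (use that assms(2) in auto)
  have fZ: "f (Z \<omega>) = ennreal (\<Prod>k<l. section_weight n N (?A \<omega>) (sc_res \<sigma> R n N L (?A \<omega>) s k) k)" for \<omega>
    unfolding f_def
  proof (intro arg_cong[where f = ennreal] prod.cong refl section_weight_cong assms(2))
    fix k i j assume k: "k \<in> {..<l}" and "i < n" "j < Suc k * N"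
    moreover have "Suc k * N \<le> l * N" using k by (intro mult_le_mono1) auto
    ultimately have "i < n" "j < l * N" by linarith+
    then show "entries I (Z \<omega>) i j = A i j \<omega>" by (auto simp: entries_def Z_def I_def)
  qed (auto simp: res)
  have gZW: "g (Z \<omega>, W \<omega>) = ennreal (section_weight n N (?A \<omega>) (sc_res \<sigma> R n N L (?A \<omega>) s l) l)" for \<omega>
    unfolding gW by (intro arg_cong[where f = ennreal] section_weight_cong assms(2) res) auto
  have "(\<integral>\<^sup>+\<omega>. ennreal (\<Prod>k<Suc l. section_weight n N (?A \<omega>) (sc_res \<sigma> R n N L (?A \<omega>) s k) k) \<partial>M)
      = (\<integral>\<^sup>+\<omega>. f (Z \<omega>) * g (Z \<omega>, W \<omega>) \<partial>M)"
    using assms(2) by (simp add: fZ gZW ennreal_mult section_weight_nonneg prod_nonneg)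
  also have "\<dots> \<le> C * C ^ l" using le Suc unfolding fZ
    by (meson Suc_leD mult_left_mono order_trans zero_le)
  finally show ?case by simp
qed

text \<open>The source is independent of the matrix, so it can be frozen and the bound for a fixed
  source applied to each value.\<close>

lemma (in prob_space) section_weight_prod_moment:
  fixes \<sigma> R :: real
  assumes indep: "indep_vars (\<lambda>_. borel) (\<lambda>(i, j). A i j) ({..<n} \<times> {..<N * L})"
    and X: "\<And>i. X i \<in> borel_measurable M"
    and indepX: "indep_set
        (sets (vimage_algebra (space M) (\<lambda>\<omega>. \<lambda>i\<in>{..<n}. X i \<omega>) (PiM {..<n} (\<lambda>_. borel))))
        (sets (vimage_algebra (space M) (\<lambda>\<omega>. \<lambda>(i, j)\<in>{..<n} \<times> {..<N * L}. A i j \<omega>)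
                 (PiM ({..<n} \<times> {..<N * L}) (\<lambda>_. borel))))"
    and N: "N > 0"
    and C: "\<And>l r. l < L \<Longrightarrow> (\<integral>\<^sup>+\<omega>. ennreal (section_weight n N (\<lambda>i j. A i j \<omega>) r l) \<partial>M) \<le> C"
  defines "V \<equiv> \<lambda>\<omega>. \<Prod>k<L. section_weight n N (\<lambda>i j. A i j \<omega>)
      (sc_res \<sigma> R n N L (\<lambda>i j. A i j \<omega>) (\<lambda>i. X i \<omega>) k) k"
  shows "V \<in> borel_measurable M" and "(\<integral>\<^sup>+\<omega>. ennreal (V \<omega>) \<partial>M) \<le> C ^ L"
proof -
  define I where "I = {..<n} \<times> {..<N * L}"
  define Z where "Z = (\<lambda>\<omega>. \<lambda>i\<in>{..<n}. X i \<omega>)"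
  define W where "W = (\<lambda>\<omega>. \<lambda>(i, j)\<in>I. A i j \<omega>)"
  let ?A = "\<lambda>\<omega> i j. A i j \<omega>"
  have Z [measurable]: "random_variable (PiM {..<n} (\<lambda>_. borel)) Z"
    unfolding Z_def using X by (intro measurable_restrict) auto
  have "(\<lambda>\<omega>. (case p of (i, j) \<Rightarrow> A i j \<omega>)) \<in> borel_measurable M" if "p \<in> I" for p
    using indep that unfolding indep_vars_def I_def by (auto simp: case_prod_beta)
  then have W [measurable]: "random_variable (PiM I (\<lambda>_. borel)) W"
    unfolding W_def by (intro measurable_restrict) auto
  have "indep_set (sets (vimage_algebra (space M) Z (PiM {..<n} (\<lambda>_. borel))))
      (sets (vimage_algebra (space M) W (PiM I (\<lambda>_. borel))))"
    unfolding Z_def W_def I_def by (rule indepX)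
  note ind = distr_pair_indep_set[OF Z W this]
  \<comment> \<open>Padding with zeros makes every coordinate measurable in \<open>z\<close>,
    including those beyond the index set.\<close>
  define v where "v z i = (if i < n then z i else 0)" for z :: "nat \<Rightarrow> real" and i
  define h where "h = (\<lambda>(z, w). \<Prod>k<L. section_weight n N (entries I w)
      (sc_res \<sigma> R n N L (entries I w) (v z) k) k)"
  have v [measurable]: "(\<lambda>z. v z i) \<in> borel_measurable (PiM {..<n} (\<lambda>_. borel))" for i
    unfolding v_def by (cases "i < n") auto
  have h: "h \<in> borel_measurable (PiM {..<n} (\<lambda>_. borel) \<Otimes>\<^sub>M PiM I (\<lambda>_. borel))"
  proof -
    have "(\<lambda>x. v (fst x) i) \<in> borel_measurable (PiM {..<n} (\<lambda>_. borel) \<Otimes>\<^sub>M PiM I (\<lambda>_. borel))"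
         "(\<lambda>x. entries I (snd x) i j) \<in> borel_measurable (PiM {..<n} (\<lambda>_. borel) \<Otimes>\<^sub>M PiM I (\<lambda>_. borel))" for i j
      by measurable
    then have "(\<lambda>x. \<Prod>k<L. section_weight n N (\<lambda>i j. entries I (snd x) i j)
       (\<lambda>i. sc_res \<sigma> R n N L (\<lambda>i j. entries I (snd x) i j) (\<lambda>i. v (fst x) i) k i) k)
       \<in> borel_measurable (PiM {..<n} (\<lambda>_. borel) \<Otimes>\<^sub>M PiM I (\<lambda>_. borel))"
      by (intro measurable_section_weight_prod)
    then show ?thesis unfolding h_def case_prod_beta by simp
  qed
  have hW: "h (z, W \<omega>) = (\<Prod>k<L. section_weight n N (?A \<omega>) (sc_res \<sigma> R n N L (?A \<omega>) s k) k)"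
    if s: "\<And>i. i < n \<Longrightarrow> v z i = s i" for z s \<omega>
  proof -
    have ent: "entries I (W \<omega>) i j = A i j \<omega>" if "k < L" "i < n" "j < Suc k * N" for k i j
    proof -
      have "Suc k * N \<le> L * N" using that by (intro mult_le_mono1) auto
      then show ?thesis using that by (auto simp: entries_def W_def I_def mult.commute)
    qed
    have "sc_res \<sigma> R n N L (entries I (W \<omega>)) (v z) k i = sc_res \<sigma> R n N L (?A \<omega>) s k i"
      if "k < L" "i < n" for k i
      using that N by (intro sc_res_cong s ent) auto
    then show ?thesis unfolding h_def case_prod_conv
      by (intro prod.cong refl section_weight_cong N) (auto simp: ent)
  qed
  have V: "V \<omega> = h (Z \<omega>, W \<omega>)" for \<omega>
    unfolding V_def by (rule hW[symmetric]) (simp add: v_def Z_def)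
  show "V \<in> borel_measurable M"
    unfolding V by (rule measurable_compose[OF _ h]) measurable
  have "(\<integral>\<^sup>+\<omega>. 1 * ennreal (h (Z \<omega>, W \<omega>)) \<partial>M) \<le> C ^ L * (\<integral>\<^sup>+\<omega>. 1 \<partial>M)"
  proof (rule nn_integral_pair_indep_le[OF Z W ind, of "\<lambda>_. 1" "\<lambda>x. ennreal (h x)"])
    fix z
    have "(\<integral>\<^sup>+\<omega>. ennreal (\<Prod>k<L. section_weight n N (?A \<omega>) (sc_res \<sigma> R n N L (?A \<omega>) (v z) k) k) \<partial>M) \<le> C ^ L"
      by (rule section_weight_prod_moment_fixed[OF indep N C]) auto
    then show "(\<integral>\<^sup>+\<omega>. ennreal (h (z, W \<omega>)) \<partial>M) \<le> C ^ L" by (simp add: hW)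
  qed (use h in auto)
  then show "(\<integral>\<^sup>+\<omega>. ennreal (V \<omega>) \<partial>M) \<le> C ^ L" by (simp add: V emeasure_space_1)
qed

section \<open>Distortion of the codeword\<close>

text \<open>Union bound over three failures: the source norm, the norms of the selected columns
  (\<open>E1\<close>), and the total score deficit (\<open>E2\<close>). Outside them
  \<open>sc_distortion_bound\<close> applies.\<close>

lemma (in prob_space) sc_distortion_probability:
  fixes A :: "nat \<Rightarrow> nat \<Rightarrow> 'a \<Rightarrow> real" and X :: "nat \<Rightarrow> 'a \<Rightarrow> real" and \<sigma> R \<delta>\<^sub>0 \<delta>\<^sub>1 \<delta>\<^sub>2 \<theta> \<Delta> :: real
  assumes X: "\<And>i. X i \<in> borel_measurable M"
    and indep: "indep_vars (\<lambda>_. borel) (\<lambda>(i, j). A i j) ({..<n} \<times> {..<N * L})"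
    and distr: "\<And>i j. i < n \<Longrightarrow> j < N * L \<Longrightarrow> distributed M lborel (A i j) (normal_density 0 (sqrt (1 / n)))"
    and indepX: "indep_set
        (sets (vimage_algebra (space M) (\<lambda>\<omega>. \<lambda>i\<in>{..<n}. X i \<omega>) (PiM {..<n} (\<lambda>_. borel))))
        (sets (vimage_algebra (space M) (\<lambda>\<omega>. \<lambda>(i, j)\<in>{..<n} \<times> {..<N * L}. A i j \<omega>)
                 (PiM ({..<n} \<times> {..<N * L}) (\<lambda>_. borel))))"
    and rate: "real L * ln (real N) = real n * R"
    and pos: "\<sigma> > 0" "R > 0" "\<delta>\<^sub>0 > 0" "\<delta>\<^sub>1 > 0" "\<delta>\<^sub>2 > 0"
    and N: "ln (real N) \<ge> 1" "score_threshold N \<ge> 0"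
    and tail: "N powr (5/4) * exp (- (real (N - 1) * (1 / sqrt (2 * ln N) *
       std_normal_density (score_threshold N + 1 / sqrt (2 * ln N))))) \<le> 4 * ln N"
    and L: "4 * R \<le> real L"
    and \<theta>: "0 \<le> \<theta>" "\<theta> \<le> 1/2"
    and \<Delta>: "exp (R / (1 - 2 * R / L)) * (\<delta>\<^sub>0 + 4 * R * (\<delta>\<^sub>1 + \<delta>\<^sub>2) / (1 - 2 * R / L)) \<le> \<Delta>"
  shows "prob {\<omega> \<in> space M.
        1 / real n * (vnorm n (\<lambda>i. X i \<omega> - sc_codeword \<sigma> R n N L (\<lambda>i j. A i j \<omega>) (\<lambda>i. X i \<omega>) i))^2
          > \<sigma>^2 * exp (-2 * R) * (1 + \<Delta>)^2}
     \<le> prob {\<omega> \<in> space M. \<bar>vnorm n (\<lambda>i. X i \<omega>) / (sqrt (real n) * \<sigma>) - 1\<bar> > \<delta>\<^sub>0}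
       + exp (n * (2 * R - L * \<theta> * (4 * \<delta>\<^sub>1 - 2 * \<theta>) / 2))
       + (8 * ln (real N) / real N powr (2 * \<delta>\<^sub>2)) ^ L" (is "prob ?bad \<le> prob ?E0 + _ + _")
proof -
  let ?A = "\<lambda>\<omega> i j. A i j \<omega>"
  define r where "r \<omega> = sc_res \<sigma> R n N L (?A \<omega>) (\<lambda>i. X i \<omega>)" for \<omega>
  define m where "m \<omega> l = sc_select n N (?A \<omega>) (r \<omega> l) l" for \<omega> l
  have N0: "N > 0" using N(1) by (cases N) auto
  have N2: "N \<ge> 2" using N(1) N0 by (cases "N = 1") auto
  have L0: "real L > 0" using L pos by linarith
  have n: "n > 0" using rate L0 N(1) by (cases n) auto
  define E1 where "E1 = (\<Union>f\<in>{..<L} \<rightarrow>\<^sub>E {..N}. {\<omega> \<in> space M.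
      L * (4 * \<delta>\<^sub>1) < (\<Sum>l\<in>{l. l < L \<and> f l < N}. (\<Sum>i<n. (A i (l * N + f l) \<omega>)\<^sup>2) - 1)})"
  have E1: "E1 \<in> events" "prob E1 \<le> exp (n * (2 * R - L * \<theta> * (4 * \<delta>\<^sub>1 - 2 * \<theta>) / 2))"
    unfolding E1_def by (rule selected_columns_tail[OF indep distr n \<theta> N2 rate]; assumption)+
  define V where "V \<omega> = (\<Prod>k<L. section_weight n N (?A \<omega>) (r \<omega> k) k)" for \<omega>
  \<comment> \<open>Since \<open>V\<close> dominates \<open>N\<close> raised to the total deficit,
    \<open>V \<le> b\<close> forces that total to be at most
    \<open>2 * \<delta>\<^sub>2 * L\<close>. Markov's inequality at this level gives the last
    summand.\<close>
  define b where "b = real N powr (2 * \<delta>\<^sub>2 * L)"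
  have b: "b > 0" using N0 by (simp add: b_def)
  define E2 where "E2 = {\<omega> \<in> space M. b < V \<omega>}"
  have C: "(\<integral>\<^sup>+\<omega>. ennreal (section_weight n N (?A \<omega>) r l) \<partial>M) \<le> ennreal (8 * ln N)" if "l < L" for l r
  proof -
    have "Suc l * N \<le> L * N" using that by (intro mult_le_mono1) auto
    then have *: "j < N * L" if "j < N + l * N" for j using that by (simp add: mult.commute)
    show ?thesis
      by (rule section_weight_moment[OF indep_vars_subset[OF indep] distr N(1) tail N(2)]) (auto intro: *)
  qed
  have V: "V \<in> borel_measurable M" "(\<integral>\<^sup>+\<omega>. ennreal (V \<omega>) \<partial>M) \<le> ennreal (8 * ln N) ^ L"
    using section_weight_prod_moment[OF indep X indepX N0 C, of \<sigma> R] unfolding V_def[abs_def] r_def by auto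
  have E2: "E2 \<in> events" unfolding E2_def using V(1) by measurable
  have "ennreal b * emeasure M E2 = (\<integral>\<^sup>+\<omega>. ennreal b * indicator E2 \<omega> \<partial>M)"
    using E2 by (simp add: nn_integral_cmult_indicator)
  also have "\<dots> \<le> (\<integral>\<^sup>+\<omega>. ennreal (V \<omega>) \<partial>M)"
    by (intro nn_integral_mono) (auto simp: E2_def indicator_def intro!: ennreal_leI)
  also have "\<dots> \<le> ennreal ((8 * ln N) ^ L)" using V(2) N(1) by (simp add: ennreal_power)
  finally have "b * prob E2 \<le> (8 * ln N) ^ L"
    using b N(1) by (simp add: emeasure_eq_measure ennreal_mult'[symmetric] ennreal_le_iff)
  moreover have "b = (real N powr (2 * \<delta>\<^sub>2)) ^ L"
    using N0 by (simp add: b_def powr_powr[symmetric] powr_realpow)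
  ultimately have pE2: "prob E2 \<le> (8 * ln N / real N powr (2 * \<delta>\<^sub>2)) ^ L"
    using b by (simp add: power_divide pos_le_divide_eq mult.commute)
  have E0: "?E0 \<in> events"
  proof -
    note [measurable] = measurable_vnorm[of X M n, OF X]
    show ?thesis by measurable
  qed
  have "?bad \<subseteq> ?E0 \<union> E1 \<union> E2"
  proof
    fix \<omega> assume bad: "\<omega> \<in> ?bad"
    show "\<omega> \<in> ?E0 \<union> E1 \<union> E2"
    proof (rule ccontr)
      assume "\<omega> \<notin> ?E0 \<union> E1 \<union> E2"
      then have not0: "\<bar>vnorm n (\<lambda>i. X i \<omega>) / (sqrt (real n) * \<sigma>) - 1\<bar> \<le> \<delta>\<^sub>0"
        and not1: "\<omega> \<notin> E1" and not2: "V \<omega> \<le> b" and \<omega>: "\<omega> \<in> space M"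
        using bad by (auto simp: E2_def)
      define q where "q l = (\<Sum>i<n. (A i (m \<omega> l) \<omega>)\<^sup>2)" for l
      define g where "g l = max 0 (q l - 1)" for l
      define e where "e l = score_deficit n N (?A \<omega>) (r \<omega> l) l" for l
      have "(\<Sum>l<L. g l) \<le> L * (4 * \<delta>\<^sub>1)"
      proof -
        \<comment> \<open>Only columns of squared norm above 1 are chosen, so the positive parts
          \<open>g\<close> become a plain sum over one of the families in \<open>E1\<close>.\<close>
        define f where "f = (\<lambda>l\<in>{..<L}. if q l > 1 then m \<omega> l - l * N else N)"
        have m: "l * N \<le> m \<omega> l" "m \<omega> l < Suc l * N" for l
          unfolding m_def using N0 by (rule sc_select_lower, intro sc_select_upper N0)
        have mf: "m \<omega> l - l * N < N" for l
          using m(1)[of l] m(2)[of l] by (simp add: less_diff_conv2)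
        have f: "f \<in> {..<L} \<rightarrow>\<^sub>E {..N}" using mf by (auto simp: f_def less_imp_le)
        have "(\<Sum>l<L. g l) = (\<Sum>l\<in>{l. l < L \<and> f l < N}. g l)"
          using mf by (intro sum.mono_neutral_right) (auto simp: f_def g_def)
        also have "\<dots> = (\<Sum>l\<in>{l. l < L \<and> f l < N}. (\<Sum>i<n. (A i (l * N + f l) \<omega>)\<^sup>2) - 1)"
          using m(1) by (intro sum.cong refl) (auto simp: f_def g_def q_def split: if_splits)
        also have "\<dots> \<le> L * (4 * \<delta>\<^sub>1)"
          using not1 f \<omega> unfolding E1_def by force
        finally show ?thesis .
      qed
      moreover have "(\<Sum>l<L. e l) \<le> 2 * \<delta>\<^sub>2 * L"
      proof -
        have "real N powr (\<Sum>l<L. e l) = (\<Prod>l<L. real N powr e l)"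
          using N0 by (simp add: powr_sum)
        also have "\<dots> \<le> V \<omega>"
          unfolding V_def e_def using N(1)
          by (intro prod_mono) (auto intro!: score_deficit_le_section_weight)
        also have "\<dots> \<le> real N powr (2 * \<delta>\<^sub>2 * L)" using not2 by (simp add: b_def)
        finally show ?thesis using N2 by (simp add: powr_le_cancel_iff)
      qed
      ultimately have sums: "(\<Sum>l<L. g l / 2 + e l) \<le> 2 * (\<delta>\<^sub>1 + \<delta>\<^sub>2) * L"
        by (simp add: sum.distrib sum_divide_distrib[symmetric] algebra_simps)
      have q0: "1 - 2 * R / L > 0" using L pos L0 by (simp add: field_simps)
      have dist: "1 / n * (vnorm n (r \<omega> L))\<^sup>2 \<le> \<sigma>\<^sup>2 * exp (-2 * R) *
         (1 + exp (R / (1 - 2 * R / L)) * (\<delta>\<^sub>0 + 2 * R / (1 - 2 * R / L) * (\<Sum>l<L. g l / 2 + e l) / L))\<^sup>2"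
        unfolding r_def
      proof (rule sc_distortion_bound[OF n N2 pos(1,2) L rate])
        show "0 \<le> \<delta>\<^sub>0" using pos by simp
        have "vnorm n (\<lambda>i. X i \<omega>) / (sqrt (real n) * \<sigma>) \<le> 1 + \<delta>\<^sub>0" using not0 by linarith
        then show "vnorm n (\<lambda>i. X i \<omega>) \<le> sqrt n * \<sigma> * (1 + \<delta>\<^sub>0)"
          using n pos(1) by (simp add: pos_divide_le_eq mult.commute)
        show "0 \<le> g l" "0 \<le> e l" for l by (simp_all add: g_def e_def score_deficit_nonneg)
        show "(\<Sum>i<n. (A i (sc_select n N (?A \<omega>) (sc_res \<sigma> R n N L (?A \<omega>) (\<lambda>i. X i \<omega>) l) l) \<omega>)\<^sup>2) \<le> 1 + g l" for l
          by (simp add: g_def q_def m_def r_def)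
        show "sqrt (2 * ln N) * (1 - e l) \<le> sc_score n (?A \<omega>) (sc_res \<sigma> R n N L (?A \<omega>) (\<lambda>i. X i \<omega>) l)
          (sc_select n N (?A \<omega>) (sc_res \<sigma> R n N L (?A \<omega>) (\<lambda>i. X i \<omega>) l) l)" (is "_ \<le> ?s")
          if "vnorm n (sc_res \<sigma> R n N L (?A \<omega>) (\<lambda>i. X i \<omega>) l) \<noteq> 0" for l
        proof -
          have "1 - e l \<le> ?s / sqrt (2 * ln N)"
            using that by (simp add: e_def score_deficit_def r_def)
          then show ?thesis using N(1) by (simp add: pos_le_divide_eq mult.commute)
        qed
      qed
      \<comment> \<open>The two totals together give at most
        \<open>2 * (\<delta>\<^sub>1 + \<delta>\<^sub>2) * L\<close>, hence the constant 4 in front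
        of \<open>R\<close>.\<close>
      have "2 * R / (1 - 2 * R / L) * (\<Sum>l<L. g l / 2 + e l) / L
          \<le> 2 * R / (1 - 2 * R / L) * (2 * (\<delta>\<^sub>1 + \<delta>\<^sub>2) * L) / L"
        using sums q0 pos(2) by (intro divide_right_mono mult_left_mono) auto
      also have "\<dots> = 4 * R * (\<delta>\<^sub>1 + \<delta>\<^sub>2) / (1 - 2 * R / L)" using L0 by simp
      finally have "exp (R / (1 - 2 * R / L)) * (\<delta>\<^sub>0 + 2 * R / (1 - 2 * R / L) * (\<Sum>l<L. g l / 2 + e l) / L)
         \<le> exp (R / (1 - 2 * R / L)) * (\<delta>\<^sub>0 + 4 * R * (\<delta>\<^sub>1 + \<delta>\<^sub>2) / (1 - 2 * R / L))"
        by (intro mult_left_mono add_left_mono) auto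
      also have "\<dots> \<le> \<Delta>" by (rule \<Delta>)
      finally have up: "exp (R / (1 - 2 * R / L)) * (\<delta>\<^sub>0 + 2 * R / (1 - 2 * R / L) * (\<Sum>l<L. g l / 2 + e l) / L) \<le> \<Delta>" .
      \<comment> \<open>Nonnegativity allows the squares to be compared.\<close>
      have "0 \<le> exp (R / (1 - 2 * R / L)) * (\<delta>\<^sub>0 + 2 * R / (1 - 2 * R / L) * (\<Sum>l<L. g l / 2 + e l) / L)"
        using pos q0 by (intro mult_nonneg_nonneg add_nonneg_nonneg divide_nonneg_nonneg sum_nonneg)
          (auto simp: g_def e_def score_deficit_nonneg)
      with up have "\<sigma>\<^sup>2 * exp (-2 * R) *
         (1 + exp (R / (1 - 2 * R / L)) * (\<delta>\<^sub>0 + 2 * R / (1 - 2 * R / L) * (\<Sum>l<L. g l / 2 + e l) / L))\<^sup>2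
         \<le> \<sigma>\<^sup>2 * exp (-2 * R) * (1 + \<Delta>)\<^sup>2"
        by (intro mult_left_mono power_mono) auto
      with dist have "1 / n * (vnorm n (r \<omega> L))\<^sup>2 \<le> \<sigma>\<^sup>2 * exp (-2 * R) * (1 + \<Delta>)\<^sup>2" by linarith
      moreover have "(\<lambda>i. X i \<omega> - sc_codeword \<sigma> R n N L (?A \<omega>) (\<lambda>i. X i \<omega>) i) = r \<omega> L"
        unfolding r_def by (rule ext) (rule sc_codeword_residual[OF N0, where s = "\<lambda>i. X i \<omega>"])
      ultimately show False using bad by simp
    qed
  qed
  then have "prob ?bad \<le> prob (?E0 \<union> E1 \<union> E2)"
    using E0 E1(1) E2 by (intro finite_measure_mono) auto
  also have "\<dots> \<le> prob ?E0 + prob E1 + prob E2"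
    using measure_Un_le[OF sets.Un[OF E0 E1(1)] E2] measure_Un_le[OF E0 E1(1)] by linarith
  finally show ?thesis using E1(2) pE2 by linarith
qed

section \<open>Choice of parameters for large \<open>M\<close> and \<open>L\<close>\<close>

theorem mainTheorem11:
  fixes P :: "'a measure" and X :: "nat \<Rightarrow> 'a \<Rightarrow> real"
    and \<sigma> R \<delta>\<^sub>0 \<delta>\<^sub>1 \<delta>\<^sub>2 :: real
  assumes "prob_space P"
    and "ergodic_process P X"
    and "\<And>i. integrable P (X i)"
    and "\<And>i. integral\<^sup>L P (X i) = 0"
    and "\<And>i. integrable P (\<lambda>\<omega>. (X i \<omega>)^2)"
    and "\<And>i. integral\<^sup>L P (\<lambda>\<omega>. (X i \<omega> - integral\<^sup>L P (X i))^2) = \<sigma>^2"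
    and "\<sigma> > 0" and "R > 0"
    and "\<delta>\<^sub>0 > 0" and "\<delta>\<^sub>1 > 0" and "\<delta>\<^sub>2 > 0"
    and "\<delta>\<^sub>0 + 5 * R * (\<delta>\<^sub>1 + \<delta>\<^sub>2) < 1/2"
  shows "\<exists>M\<^sub>0 L\<^sub>0. \<forall>M\<ge>M\<^sub>0. \<forall>L\<ge>L\<^sub>0. \<forall>(n::nat) (A :: nat \<Rightarrow> nat \<Rightarrow> 'a \<Rightarrow> real).
     real L * ln (real M) = real n * R \<longrightarrow>
     prob_space.indep_vars P (\<lambda>_. borel) (\<lambda>(i, j). A i j) ({..<n} \<times> {..<M * L}) \<longrightarrow>
     (\<forall>i<n. \<forall>j<M * L. distributed P lborel (A i j) (normal_density 0 (sqrt (1 / real n)))) \<longrightarrow>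
     prob_space.indep_set P
        (sets (vimage_algebra (space P) (\<lambda>\<omega>. \<lambda>i\<in>{..<n}. X i \<omega>) (PiM {..<n} (\<lambda>_. borel))))
        (sets (vimage_algebra (space P) (\<lambda>\<omega>. \<lambda>(i, j)\<in>{..<n} \<times> {..<M * L}. A i j \<omega>)
                 (PiM ({..<n} \<times> {..<M * L}) (\<lambda>_. borel)))) \<longrightarrow>
     measure P {\<omega> \<in> space P.
        1 / real n * (vnorm n (\<lambda>i. X i \<omega> - sc_codeword \<sigma> R n M L (\<lambda>i j. A i j \<omega>) (\<lambda>i. X i \<omega>) i))^2
          > \<sigma>^2 * exp (-2 * R) * (1 + exp R * (\<delta>\<^sub>0 + 5 * R * (\<delta>\<^sub>1 + \<delta>\<^sub>2)))^2}
     < measure P {\<omega> \<in> space P. \<bar>vnorm n (\<lambda>i. X i \<omega>) / (sqrt (real n) * \<sigma>) - 1\<bar> > \<delta>\<^sub>0}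
       + 2 * real M * real L * exp (- real n * \<delta>\<^sub>1^2 / 8)
       + (8 * ln (real M) / real M powr (2 * \<delta>\<^sub>2)) ^ L"
proof -
  interpret prob_space P by fact
  \<comment> \<open>The cap \<open>1/2\<close> is the range of the Chernoff bound;
    \<open>\<theta> \<le> \<delta>\<^sub>1\<close> makes the factor
    \<open>4 * \<delta>\<^sub>1 - 2 * \<theta>\<close> positive.\<close>
  define \<theta> where "\<theta> = min \<delta>\<^sub>1 (1/2)"
  have \<theta>: "0 < \<theta>" "\<theta> \<le> 1/2" "2 * \<theta> < 4 * \<delta>\<^sub>1" using assms(10) by (auto simp: \<theta>_def)
  have X: "X i \<in> borel_measurable P" for i
    using assms(2) by (simp add: ergodic_process_def stationary_process_def)
  have "\<forall>\<^sub>F N :: nat in sequentially. ln (real N) \<ge> 1 \<and> score_threshold N \<ge> 0 \<and>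
     N powr (5/4) * exp (- (real (N - 1) * (1 / sqrt (2 * ln N) *
       std_normal_density (score_threshold N + 1 / sqrt (2 * ln N))))) \<le> 4 * ln N"
  proof (intro eventually_conj gaussian_max_threshold_tail)
    show "\<forall>\<^sub>F N :: nat in sequentially. ln (real N) \<ge> 1" by real_asymp
    show "\<forall>\<^sub>F N :: nat in sequentially. score_threshold N \<ge> 0" unfolding score_threshold_def by real_asymp
  qed
  then obtain M\<^sub>0 where M\<^sub>0: "\<forall>N\<ge>M\<^sub>0. ln (real N) \<ge> 1 \<and> score_threshold N \<ge> 0 \<and>
     N powr (5/4) * exp (- (real (N - 1) * (1 / sqrt (2 * ln N) *
       std_normal_density (score_threshold N + 1 / sqrt (2 * ln N))))) \<le> 4 * ln N"
    unfolding eventually_sequentially ..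
  let ?D = "exp R * (\<delta>\<^sub>0 + 5 * R * (\<delta>\<^sub>1 + \<delta>\<^sub>2))"
  have "\<forall>\<^sub>F L :: nat in sequentially. 4 * R \<le> real L \<and>
     exp (R / (1 - 2 * R / L)) * (\<delta>\<^sub>0 + 4 * R * (\<delta>\<^sub>1 + \<delta>\<^sub>2) / (1 - 2 * R / L)) \<le> ?D \<and>
     2 * R - L * \<theta> * (4 * \<delta>\<^sub>1 - 2 * \<theta>) / 2 \<le> - \<delta>\<^sub>1\<^sup>2 / 8"
  proof (intro eventually_conj)
    show "\<forall>\<^sub>F L :: nat in sequentially. 4 * R \<le> real L" by real_asymp
    have "(\<lambda>L::nat. 2 * R / L) \<longlonglongrightarrow> 0" by real_asymp
    then have "(\<lambda>L::nat. exp (R / (1 - 2 * R / L)) * (\<delta>\<^sub>0 + 4 * R * (\<delta>\<^sub>1 + \<delta>\<^sub>2) / (1 - 2 * R / L)))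
      \<longlonglongrightarrow> exp (R / (1 - 0)) * (\<delta>\<^sub>0 + 4 * R * (\<delta>\<^sub>1 + \<delta>\<^sub>2) / (1 - 0))"
      by (intro tendsto_intros) auto
    \<comment> \<open>The gap between the constants 4 and 5 makes the limit strictly smaller than
      \<open>?D\<close>, so the bound holds for all large \<open>L\<close>.\<close>
    moreover have "exp (R / (1 - 0)) * (\<delta>\<^sub>0 + 4 * R * (\<delta>\<^sub>1 + \<delta>\<^sub>2) / (1 - 0)) < ?D"
      using assms(8,10,11) by simp
    ultimately have "\<forall>\<^sub>F L :: nat in sequentially.
       exp (R / (1 - 2 * R / L)) * (\<delta>\<^sub>0 + 4 * R * (\<delta>\<^sub>1 + \<delta>\<^sub>2) / (1 - 2 * R / L)) < ?D"
      by (rule order_tendstoD(2))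
    then show "\<forall>\<^sub>F L :: nat in sequentially.
       exp (R / (1 - 2 * R / L)) * (\<delta>\<^sub>0 + 4 * R * (\<delta>\<^sub>1 + \<delta>\<^sub>2) / (1 - 2 * R / L)) \<le> ?D"
      by eventually_elim simp
    define k where "k = \<theta> * (4 * \<delta>\<^sub>1 - 2 * \<theta>)"
    have k: "k > 0" using \<theta> by (simp add: k_def)
    \<comment> \<open>The exponent per unit of \<open>n\<close> decreases linearly in
      \<open>L\<close>, so it passes below any fixed level.\<close>
    then have "\<forall>\<^sub>F L :: nat in sequentially. 2 * R - L * k / 2 \<le> - \<delta>\<^sub>1\<^sup>2 / 8" by real_asymp
    then show "\<forall>\<^sub>F L :: nat in sequentially. 2 * R - L * \<theta> * (4 * \<delta>\<^sub>1 - 2 * \<theta>) / 2 \<le> - \<delta>\<^sub>1\<^sup>2 / 8"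
      by (simp add: k_def mult.assoc)
  qed
  then obtain L\<^sub>0 where L\<^sub>0: "\<forall>L\<ge>L\<^sub>0. 4 * R \<le> real L \<and>
     exp (R / (1 - 2 * R / L)) * (\<delta>\<^sub>0 + 4 * R * (\<delta>\<^sub>1 + \<delta>\<^sub>2) / (1 - 2 * R / L)) \<le> ?D \<and>
     2 * R - L * \<theta> * (4 * \<delta>\<^sub>1 - 2 * \<theta>) / 2 \<le> - \<delta>\<^sub>1\<^sup>2 / 8"
    unfolding eventually_sequentially ..
  show ?thesis
  proof (rule exI[of _ M\<^sub>0], rule exI[of _ L\<^sub>0], intro allI impI, goal_cases)
    case (1 M L n A)
    note hyps = this
    note large = M\<^sub>0[rule_format, OF hyps(1)] L\<^sub>0[rule_format, OF hyps(2)]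
    have distr: "distributed P lborel (A i j) (normal_density 0 (sqrt (1 / real n)))" if "i < n" "j < M * L" for i j
      using hyps(5) that by blast
    have M0: "M > 0" using large(1) by (cases M) auto
    have L0: "L > 0" using large(2) assms(8) by (cases L) auto
    have "exp (n * (2 * R - L * \<theta> * (4 * \<delta>\<^sub>1 - 2 * \<theta>) / 2)) \<le> exp (- real n * \<delta>\<^sub>1\<^sup>2 / 8)"
      using mult_left_mono[OF conjunct2[OF conjunct2[OF large(2)]], of "real n"] by simp
    \<comment> \<open>The factor \<open>2 * M * L\<close>, larger than 1, supplies the strict
      inequality of the conclusion.\<close>
    also have "\<dots> < 2 * real M * real L * exp (- real n * \<delta>\<^sub>1\<^sup>2 / 8)"
    proof -
      have "1 * 1 \<le> real M * real L" using M0 L0 by (intro mult_mono) auto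
      then have "1 < 2 * real M * real L" by simp
      then show ?thesis by simp
    qed
    finally have "exp (n * (2 * R - L * \<theta> * (4 * \<delta>\<^sub>1 - 2 * \<theta>) / 2)) < 2 * real M * real L * exp (- real n * \<delta>\<^sub>1\<^sup>2 / 8)" .
    moreover note sc_distortion_probability[OF X hyps(4) distr hyps(6) hyps(3) assms(7,8,9,10,11), of \<theta> ?D]
    ultimately show ?case using large \<theta> by simp
  qed
qed

end
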